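(* We have $U_{(-1)}=BH\cong B\otimes H$ (isomorphism of associative algebras).
   Context: $\bar S_2$ is the complex Lie algebra of polynomial vector fields $p_1\partial_1+p_2\partial_2$, $p_i\in\mathbb C[t_1,t_2]$, $\partial_i=\partial/\partial t_i$, with constant divergence $\partial_1(p_1)+\partial_2(p_2)\in\mathbb C$; $d_i=t_i\partial_i$; $\otimes=\otimes_{\mathbb C}$. The set $\{\partial_1^{i_1}\partial_2^{i_2}\mid i_1,i_2\in\mathbb Z_+\}$ is an Ore subset of $U(\bar S_2)$; $U_{(-1)}$ is the localization of $U(\bar S_2)$ at this set, and $$H=\{u\in U_{(-1)}\mid[u,\partial_i]=[u,d_i]=0,\ i=1,2\},$$ a subalgebra of $U_{(-1)}$. $B$ is the subalgebra of $U_{(-1)}$ generated by $\partial_i,d_i,\partial_i^{-1}$, $i=1,2$. $BH$ denotes the span of products $bu$ with $b\in B$, $u\in H$. *)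

theory Defs
  imports
    "HOL-Library.Poly_Mapping"
    "HOL-Library.Product_Plus"
    "HOL-Computational_Algebra.Polynomial"
    "HOL-Algebra.Module"
    "HOL-Algebra.QuotRing"
    "HOL-Algebra.Subrings"
begin

section \<open>Associative unital algebras over the complex numbers\<close>

definition complex_ring :: "complex ring"
  where "complex_ring = \<lparr>carrier = UNIV, mult = (*), one = 1, zero = 0, add = (+)\<rparr>"

text \<open>The locale \<open>algebra\<close> of HOL-Algebra only covers commutative algebras.\<close>

locale complex_algebra = module complex_ring A + ring A for A (structure) +
  assumes smult_mult_left:
      "\<lbrakk>x \<in> carrier A; y \<in> carrier A\<rbrakk> \<Longrightarrow> (c \<odot> x) \<otimes> y = c \<odot> (x \<otimes> y)"
    and smult_mult_right:
      "\<lbrakk>x \<in> carrier A; y \<in> carrier A\<rbrakk> \<Longrightarrow> x \<otimes> (c \<odot> y) = c \<odot> (x \<otimes> y)"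

definition alg_hom :: "(complex, 'a) module \<Rightarrow> (complex, 'b) module \<Rightarrow> ('a \<Rightarrow> 'b) set"
  where "alg_hom A B =
    {f \<in> ring_hom A B. \<forall>c. \<forall>x\<in>carrier A. f (c \<odot>\<^bsub>A\<^esub> x) = c \<odot>\<^bsub>B\<^esub> f x}"

definition alg_iso :: "(complex, 'a) module \<Rightarrow> (complex, 'b) module \<Rightarrow> ('a \<Rightarrow> 'b) set"
  where "alg_iso A B = {f \<in> alg_hom A B. bij_betw f (carrier A) (carrier B)}"

definition is_subalg :: "'a set \<Rightarrow> (complex, 'a) module \<Rightarrow> bool"
  where "is_subalg N A \<longleftrightarrow> subring N A \<and> submodule N complex_ring A"

definition generated_subalg :: "(complex, 'a) module \<Rightarrow> 'a set \<Rightarrow> 'a set"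
  where "generated_subalg A X = \<Inter>{N. is_subalg N A \<and> X \<subseteq> N}"

definition linear_span :: "(complex, 'a) module \<Rightarrow> 'a set \<Rightarrow> 'a set"
  where "linear_span A X = \<Inter>{N. submodule N complex_ring A \<and> X \<subseteq> N}"

definition commutator :: "(complex, 'a) module \<Rightarrow> 'a \<Rightarrow> 'a \<Rightarrow> 'a"
  where "commutator A x y = (x \<otimes>\<^bsub>A\<^esub> y) \<ominus>\<^bsub>A\<^esub> (y \<otimes>\<^bsub>A\<^esub> x)"

definition quotient_alg :: "(complex, 'a) module \<Rightarrow> 'a set \<Rightarrow> (complex, 'a set) module"
  where "quotient_alg A I =
    \<lparr>carrier = carrier (A Quot I), mult = mult (A Quot I), one = one (A Quot I),
     zero = zero (A Quot I), add = add (A Quot I),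
     smult = (\<lambda>c X. \<Union>x\<in>X. I +>\<^bsub>A\<^esub> (c \<odot>\<^bsub>A\<^esub> x))\<rparr>"

text \<open>The monoid algebra of \<open>M\<close>: its elements are the finitely supported functions on the
  carrier of \<open>M\<close>, with convolution as product; \<open>single x 1\<close> is the basis vector of \<open>x\<close>.\<close>

definition monoid_alg :: "('m, 'z) monoid_scheme \<Rightarrow> (complex, 'm \<Rightarrow>\<^sub>0 complex) module"
  where "monoid_alg M =
    \<lparr>carrier = {f. Poly_Mapping.keys f \<subseteq> carrier M},
     mult = (\<lambda>f g. \<Sum>x\<in>Poly_Mapping.keys f. \<Sum>y\<in>Poly_Mapping.keys g.
               Poly_Mapping.single (x \<otimes>\<^bsub>M\<^esub> y) (Poly_Mapping.lookup f x * Poly_Mapping.lookup g y)),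
     one = Poly_Mapping.single \<one>\<^bsub>M\<^esub> 1,
     zero = 0,
     add = (+),
     smult = (\<lambda>c f. Poly_Mapping.map ((*) c) f)\<rparr>"

section \<open>Tensor products of algebras\<close>

text \<open>The product \<open>(a, b) (a', b') = (a a', b b')\<close> on basis vectors turns the free vector space
  on \<open>A \<times> B\<close> into a monoid algebra. Multiplying one of the bilinearity relations below by a
  basis vector gives another such relation, so the ideal they generate is their linear span:
  the quotient is the usual vector space tensor product, with the usual multiplication.\<close>

definition tensor_relations ::
    "(complex, 'a) module \<Rightarrow> (complex, 'b) module \<Rightarrow> ('a \<times> 'b \<Rightarrow>\<^sub>0 complex) set"
  where "tensor_relations A B =
      {Poly_Mapping.single (a \<oplus>\<^bsub>A\<^esub> a', b) 1 - Poly_Mapping.single (a, b) 1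
         - Poly_Mapping.single (a', b) 1
       | a a' b. a \<in> carrier A \<and> a' \<in> carrier A \<and> b \<in> carrier B}
    \<union> {Poly_Mapping.single (a, b \<oplus>\<^bsub>B\<^esub> b') 1 - Poly_Mapping.single (a, b) 1
         - Poly_Mapping.single (a, b') 1
       | a b b'. a \<in> carrier A \<and> b \<in> carrier B \<and> b' \<in> carrier B}
    \<union> {Poly_Mapping.single (c \<odot>\<^bsub>A\<^esub> a, b) 1 - Poly_Mapping.single (a, b) c
       | c a b. a \<in> carrier A \<and> b \<in> carrier B}
    \<union> {Poly_Mapping.single (a, c \<odot>\<^bsub>B\<^esub> b) 1 - Poly_Mapping.single (a, b) c
       | c a b. a \<in> carrier A \<and> b \<in> carrier B}"

definition tensor_ideal ::
    "(complex, 'a) module \<Rightarrow> (complex, 'b) module \<Rightarrow> ('a \<times> 'b \<Rightarrow>\<^sub>0 complex) set"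
  where "tensor_ideal A B = genideal (monoid_alg (A \<times>\<times> B)) (tensor_relations A B)"

definition tensor_alg ::
    "(complex, 'a) module \<Rightarrow> (complex, 'b) module \<Rightarrow> (complex, ('a \<times> 'b \<Rightarrow>\<^sub>0 complex) set) module"
  where "tensor_alg A B = quotient_alg (monoid_alg (A \<times>\<times> B)) (tensor_ideal A B)"

definition pure_tensor ::
    "(complex, 'a) module \<Rightarrow> (complex, 'b) module \<Rightarrow> 'a \<Rightarrow> 'b \<Rightarrow> ('a \<times> 'b \<Rightarrow>\<^sub>0 complex) set"
  where "pure_tensor A B a b =
    tensor_ideal A B +>\<^bsub>monoid_alg (A \<times>\<times> B)\<^esub> Poly_Mapping.single (a, b) 1"

section \<open>Universal enveloping algebras\<close>

definition word_monoid :: "'l set \<Rightarrow> 'l list monoid"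
  where "word_monoid L = \<lparr>carrier = lists L, mult = (@), one = []\<rparr>"

text \<open>\<open>U(L)\<close> for a Lie algebra with carrier \<open>L\<close>, scalar multiplication \<open>sc\<close> and bracket \<open>br\<close>: the
  free associative algebra on the set \<open>L\<close> modulo linearity of the generators (which gives the
  tensor algebra of the vector space \<open>L\<close>) and \<open>x y - y x = [x, y]\<close>.\<close>

definition env_relations ::
    "'l::ab_group_add set \<Rightarrow> (complex \<Rightarrow> 'l \<Rightarrow> 'l) \<Rightarrow> ('l \<Rightarrow> 'l \<Rightarrow> 'l) \<Rightarrow> ('l list \<Rightarrow>\<^sub>0 complex) set"
  where "env_relations L sc br =
      {Poly_Mapping.single [x + y] 1 - Poly_Mapping.single [x] 1 - Poly_Mapping.single [y] 1
       | x y. x \<in> L \<and> y \<in> L}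
    \<union> {Poly_Mapping.single [sc c x] 1 - Poly_Mapping.single [x] c | c x. x \<in> L}
    \<union> {Poly_Mapping.single [x, y] 1 - Poly_Mapping.single [y, x] 1
         - Poly_Mapping.single [br x y] 1
       | x y. x \<in> L \<and> y \<in> L}"

definition env_ideal ::
    "'l::ab_group_add set \<Rightarrow> (complex \<Rightarrow> 'l \<Rightarrow> 'l) \<Rightarrow> ('l \<Rightarrow> 'l \<Rightarrow> 'l) \<Rightarrow> ('l list \<Rightarrow>\<^sub>0 complex) set"
  where "env_ideal L sc br = genideal (monoid_alg (word_monoid L)) (env_relations L sc br)"

definition env_alg ::
    "'l::ab_group_add set \<Rightarrow> (complex \<Rightarrow> 'l \<Rightarrow> 'l) \<Rightarrow> ('l \<Rightarrow> 'l \<Rightarrow> 'l)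
      \<Rightarrow> (complex, ('l list \<Rightarrow>\<^sub>0 complex) set) module"
  where "env_alg L sc br = quotient_alg (monoid_alg (word_monoid L)) (env_ideal L sc br)"

definition env_incl ::
    "'l::ab_group_add set \<Rightarrow> (complex \<Rightarrow> 'l \<Rightarrow> 'l) \<Rightarrow> ('l \<Rightarrow> 'l \<Rightarrow> 'l)
      \<Rightarrow> 'l \<Rightarrow> ('l list \<Rightarrow>\<^sub>0 complex) set"
  where "env_incl L sc br x =
    env_ideal L sc br +>\<^bsub>monoid_alg (word_monoid L)\<^esub> Poly_Mapping.single [x] 1"

section \<open>Ore localization\<close>

text \<open>\<open>\<phi>\<close> exhibits \<open>Q\<close> as the localization \<open>S\<^sup>-\<^sup>1 U\<close> (ring of left fractions) of \<open>U\<close> at \<open>S\<close>.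
  For a multiplicative set \<open>S\<close> this determines \<open>(Q, \<phi>)\<close> up to unique isomorphism; if \<open>S\<close> satisfies
  both Ore conditions, the left and right localizations coincide.\<close>

definition is_ore_localization ::
    "(complex, 'u) module \<Rightarrow> 'u set \<Rightarrow> (complex, 'q) module \<Rightarrow> ('u \<Rightarrow> 'q) \<Rightarrow> bool"
  where "is_ore_localization U S Q \<phi> \<longleftrightarrow>
    complex_algebra Q \<and> \<phi> \<in> alg_hom U Q
    \<and> (\<forall>s\<in>S. \<phi> s \<in> Units Q)
    \<and> (\<forall>q\<in>carrier Q. \<exists>s\<in>S. \<exists>u\<in>carrier U. q = inv\<^bsub>Q\<^esub> (\<phi> s) \<otimes>\<^bsub>Q\<^esub> \<phi> u)
    \<and> (\<forall>u\<in>carrier U. \<phi> u = \<zero>\<^bsub>Q\<^esub> \<longleftrightarrow> (\<exists>s\<in>S. s \<otimes>\<^bsub>U\<^esub> u = \<zero>\<^bsub>U\<^esub>))"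

section \<open>Vector fields with constant divergence in the plane\<close>

text \<open>\<open>\<complex>[t\<^sub>1, t\<^sub>2]\<close> is represented as \<open>\<complex>[t\<^sub>1][t\<^sub>2]\<close>: the outer variable is \<open>t\<^sub>2\<close>.\<close>

type_synonym poly2 = "complex poly poly"

definition t1 :: poly2 where "t1 = [:[:0, 1:]:]"
definition t2 :: poly2 where "t2 = [:0, 1:]"

definition pd1 :: "poly2 \<Rightarrow> poly2" where "pd1 = map_poly pderiv"
definition pd2 :: "poly2 \<Rightarrow> poly2" where "pd2 = pderiv"

text \<open>The pair \<open>(p\<^sub>1, p\<^sub>2)\<close> stands for \<open>p\<^sub>1 \<partial>\<^sub>1 + p\<^sub>2 \<partial>\<^sub>2\<close>.\<close>

type_synonym vfield = "poly2 \<times> poly2"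

definition vf_apply :: "vfield \<Rightarrow> poly2 \<Rightarrow> poly2"
  where "vf_apply p f = fst p * pd1 f + snd p * pd2 f"

definition vf_bracket :: "vfield \<Rightarrow> vfield \<Rightarrow> vfield"
  where "vf_bracket p q =
    (vf_apply p (fst q) - vf_apply q (fst p), vf_apply p (snd q) - vf_apply q (snd p))"

definition vf_scale :: "complex \<Rightarrow> vfield \<Rightarrow> vfield"
  where "vf_scale c p = ([:[:c:]:] * fst p, [:[:c:]:] * snd p)"

definition Sbar2 :: "vfield set"
  where "Sbar2 = {p. \<exists>c. pd1 (fst p) + pd2 (snd p) = [:[:c:]:]}"

definition U_Sbar2 :: "(complex, (vfield list \<Rightarrow>\<^sub>0 complex) set) module"
  where "U_Sbar2 = env_alg Sbar2 vf_scale vf_bracket"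

definition vf_incl :: "vfield \<Rightarrow> (vfield list \<Rightarrow>\<^sub>0 complex) set"
  where "vf_incl = env_incl Sbar2 vf_scale vf_bracket"

definition del1 :: "(vfield list \<Rightarrow>\<^sub>0 complex) set" where "del1 = vf_incl (1, 0)"
definition del2 :: "(vfield list \<Rightarrow>\<^sub>0 complex) set" where "del2 = vf_incl (0, 1)"
definition d1 :: "(vfield list \<Rightarrow>\<^sub>0 complex) set" where "d1 = vf_incl (t1, 0)"
definition d2 :: "(vfield list \<Rightarrow>\<^sub>0 complex) set" where "d2 = vf_incl (0, t2)"

definition del_powers :: "(vfield list \<Rightarrow>\<^sub>0 complex) set set"
  where "del_powers =
    {(del1 [^]\<^bsub>U_Sbar2\<^esub> i1) \<otimes>\<^bsub>U_Sbar2\<^esub> (del2 [^]\<^bsub>U_Sbar2\<^esub> i2) | (i1::nat) (i2::nat). True}"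

section \<open>The subalgebras \<open>B\<close> and \<open>H\<close> of a localization \<open>\<phi> : U \<rightarrow> Q\<close>\<close>

definition H_alg ::
    "(complex, 'q) module \<Rightarrow> ((vfield list \<Rightarrow>\<^sub>0 complex) set \<Rightarrow> 'q) \<Rightarrow> 'q set"
  where "H_alg Q \<phi> =
    {u \<in> carrier Q. \<forall>v\<in>{del1, del2, d1, d2}. commutator Q u (\<phi> v) = \<zero>\<^bsub>Q\<^esub>}"

definition B_alg ::
    "(complex, 'q) module \<Rightarrow> ((vfield list \<Rightarrow>\<^sub>0 complex) set \<Rightarrow> 'q) \<Rightarrow> 'q set"
  where "B_alg Q \<phi> = generated_subalg Q
    {\<phi> del1, \<phi> del2, \<phi> d1, \<phi> d2, inv\<^bsub>Q\<^esub> (\<phi> del1), inv\<^bsub>Q\<^esub> (\<phi> del2)}"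

definition BH ::
    "(complex, 'q) module \<Rightarrow> ((vfield list \<Rightarrow>\<^sub>0 complex) set \<Rightarrow> 'q) \<Rightarrow> 'q set"
  where "BH Q \<phi> = linear_span Q {b \<otimes>\<^bsub>Q\<^esub> u | b u. b \<in> B_alg Q \<phi> \<and> u \<in> H_alg Q \<phi>}"

end

theory Submission
  imports Defs
begin

text \<open>
  Inside the localization \<open>Q\<close>, put \<open>t\<^sub>i = d\<^sub>i \<partial>\<^sub>i\<^sup>-\<^sup>1\<close>. Then \<open>[\<partial>\<^sub>i, t\<^sub>j] = \<delta>\<^sub>i\<^sub>j\<close>, so \<open>B\<close> is a Weyl algebra
  in two variables with the \<open>\<partial>\<^sub>i\<close> inverted: it is spanned by the monomials
  \<open>\<partial>\<^sub>1\<^sup>a \<partial>\<^sub>2\<^sup>b t\<^sub>1\<^sup>k t\<^sub>2\<^sup>l\<close> with \<open>a, b\<close> integers and \<open>k, l\<close> naturals, and \<open>H\<close> is its centralizer. Because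
  \<open>B\<close> and \<open>H\<close> commute, \<open>b \<otimes> u \<mapsto> b u\<close> extends to an algebra homomorphism \<open>\<mu>\<close> from \<open>B \<otimes> H\<close> to \<open>Q\<close>,
  and the claim is that \<open>\<mu>\<close> is bijective.

  Injectivity. Every tensor is a sum of terms \<open>m\<^sub>i \<otimes> h\<^sub>i\<close> with distinct monomials \<open>m\<^sub>i\<close>
  (\<open>expansion_exists\<close>), so it suffices that the monomials are independent over \<open>H\<close>
  (\<open>monomial_independent\<close>). The derivation \<open>[\<partial>\<^sub>1, -]\<close> kills \<open>H\<close> and all factors except \<open>t\<^sub>1\<^sup>k\<close>, which it
  sends to \<open>k t\<^sub>1\<^sup>k\<^sup>-\<^sup>1\<close>, and similarly for \<open>\<partial>\<^sub>2\<close>; by induction on the degree in \<open>t\<close>, a relation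
  involves only the monomials \<open>\<partial>\<^sub>1\<^sup>a \<partial>\<^sub>2\<^sup>b\<close>. On these, \<open>[d\<^sub>1, -]\<close> and \<open>[d\<^sub>2, -]\<close> act with the
  eigenvalues \<open>-a\<close> and \<open>-b\<close>, which together tell all the terms apart.

  Surjectivity. The image \<open>K\<close> of \<open>\<mu>\<close> is a subalgebra that contains \<open>B\<close>, hence the inverses of all
  denominators, so it is enough that it contains the vector fields. A field of constant divergence
  is a multiple of \<open>d\<^sub>1\<close> plus the Hamiltonian field of a polynomial (\<open>Sbar2_decompose\<close>), and
  by linearity the polynomial may be taken to be a monomial \<open>t\<^sub>1\<^sup>i t\<^sub>2\<^sup>j\<close>. The field \<open>x\<close> is then a
  common eigenvector of \<open>[d\<^sub>1, -]\<close> and \<open>[d\<^sub>2, -]\<close> with the integer eigenvalues \<open>i - 1\<close> and \<open>j - 1\<close>,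
  and a power of each \<open>[\<partial>\<^sub>i, -]\<close> kills it. All such \<open>x\<close> lie in \<open>K\<close>
  (\<open>nilpotent_weight_vector_mem\<close>): by Taylor expansion in the \<open>t\<^sub>i\<close> one may assume that \<open>x\<close> commutes
  with \<open>\<partial>\<^sub>1\<close> and \<open>\<partial>\<^sub>2\<close>, and if its eigenvalues are \<open>m\<^sub>1, m\<^sub>2\<close>, then \<open>\<partial>\<^sub>1\<^bsup>m\<^sub>1\<^esup> \<partial>\<^sub>2\<^bsup>m\<^sub>2\<^esup> x\<close> commutes with
  the \<open>d\<^sub>i\<close> as well, so it lies in \<open>H\<close>.
\<close>

section \<open>Algebras over the complex numbers\<close>

lemma cring_complex_ring: "cring complex_ring"
proof (rule cringI)
  show "abelian_group complex_ring"
  proof (rule abelian_groupI)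
    show "\<exists>y\<in>carrier complex_ring. y \<oplus>\<^bsub>complex_ring\<^esub> x = \<zero>\<^bsub>complex_ring\<^esub>" for x
      by (rule bexI[of _ "- x"]) (auto simp: complex_ring_def)
  qed (auto simp: complex_ring_def)
  show "Group.comm_monoid complex_ring"
    by (rule comm_monoidI) (auto simp: complex_ring_def)
qed (auto simp: complex_ring_def algebra_simps)

lemma complex_algebraI:
  assumes "ring A"
    and "\<And>c x. x \<in> carrier A \<Longrightarrow> c \<odot>\<^bsub>A\<^esub> x \<in> carrier A"
    and "\<And>c d x. x \<in> carrier A \<Longrightarrow> (c + d) \<odot>\<^bsub>A\<^esub> x = c \<odot>\<^bsub>A\<^esub> x \<oplus>\<^bsub>A\<^esub> d \<odot>\<^bsub>A\<^esub> x"
    and "\<And>c x y. x \<in> carrier A \<Longrightarrow> y \<in> carrier A \<Longrightarrow>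
      c \<odot>\<^bsub>A\<^esub> (x \<oplus>\<^bsub>A\<^esub> y) = c \<odot>\<^bsub>A\<^esub> x \<oplus>\<^bsub>A\<^esub> c \<odot>\<^bsub>A\<^esub> y"
    and "\<And>c d x. x \<in> carrier A \<Longrightarrow> (c * d) \<odot>\<^bsub>A\<^esub> x = c \<odot>\<^bsub>A\<^esub> (d \<odot>\<^bsub>A\<^esub> x)"
    and "\<And>x. x \<in> carrier A \<Longrightarrow> 1 \<odot>\<^bsub>A\<^esub> x = x"
    and "\<And>c x y. x \<in> carrier A \<Longrightarrow> y \<in> carrier A \<Longrightarrow>
      (c \<odot>\<^bsub>A\<^esub> x) \<otimes>\<^bsub>A\<^esub> y = c \<odot>\<^bsub>A\<^esub> (x \<otimes>\<^bsub>A\<^esub> y)"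
    and "\<And>c x y. x \<in> carrier A \<Longrightarrow> y \<in> carrier A \<Longrightarrow>
      x \<otimes>\<^bsub>A\<^esub> (c \<odot>\<^bsub>A\<^esub> y) = c \<odot>\<^bsub>A\<^esub> (x \<otimes>\<^bsub>A\<^esub> y)"
  shows "complex_algebra A"
proof -
  interpret ring A by fact
  have "module complex_ring A"
    by (rule moduleI) (use assms cring_complex_ring is_abelian_group in \<open>auto simp: complex_ring_def\<close>)
  then show ?thesis
    by (intro complex_algebra.intro complex_algebra_axioms.intro) (use assms in auto)
qed

text \<open>The operations on algebras (subalgebras, spans, homomorphisms) are defined for records of type
\<open>module\<close> without further fields; the locale fixes this type.\<close>

locale complex_alg = complex_algebra A for A :: "(complex, 'a) module" (structure)
begin

lemma scale_closed [simp, intro]: "x \<in> carrier A \<Longrightarrow> c \<odot> x \<in> carrier A"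
  using smult_closed[of c x] by (simp add: complex_ring_def)

lemma scale_add_left: "x \<in> carrier A \<Longrightarrow> (c + d) \<odot> x = c \<odot> x \<oplus> d \<odot> x"
  using smult_l_distr[of c d x] by (simp add: complex_ring_def)

lemma scale_add_right: "x \<in> carrier A \<Longrightarrow> y \<in> carrier A \<Longrightarrow> c \<odot> (x \<oplus> y) = c \<odot> x \<oplus> c \<odot> y"
  using smult_r_distr[of c x y] by (simp add: complex_ring_def)

lemma scale_scale [simp]: "x \<in> carrier A \<Longrightarrow> c \<odot> (d \<odot> x) = (c * d) \<odot> x"
  using smult_assoc1[of c d x] by (simp add: complex_ring_def)

lemma scale_one [simp]: "x \<in> carrier A \<Longrightarrow> 1 \<odot> x = x"
  using smult_one[of x] by (simp add: complex_ring_def)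

lemma scale_zero_left [simp]: "x \<in> carrier A \<Longrightarrow> 0 \<odot> x = \<zero>"
  using smult_l_null[of x] by (simp add: complex_ring_def)

lemma scale_zero_right [simp]: "c \<odot> \<zero> = \<zero>"
  using smult_r_null[of c] by (simp add: complex_ring_def)

lemma minus_eq_scale: "x \<in> carrier A \<Longrightarrow> \<ominus> x = (-1) \<odot> x"
  using scale_add_left[of x 1 "-1"] minus_equality[of "(-1) \<odot> x" x]
  by (simp add: a_comm)

lemma scale_minus [simp]: "x \<in> carrier A \<Longrightarrow> c \<odot> (\<ominus> x) = (- c) \<odot> x"
  by (simp add: minus_eq_scale)

lemma minus_scale [simp]: "x \<in> carrier A \<Longrightarrow> \<ominus> (c \<odot> x) = (- c) \<odot> x"
  by (simp add: minus_eq_scale)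

lemma scale_eq_zeroD: "c \<odot> x = \<zero> \<Longrightarrow> x \<in> carrier A \<Longrightarrow> c \<noteq> 0 \<Longrightarrow> x = \<zero>"
  using scale_scale[of x "inverse c" c] by simp

lemma scale_diff_right:
  "x \<in> carrier A \<Longrightarrow> y \<in> carrier A \<Longrightarrow> c \<odot> (x \<ominus> y) = c \<odot> x \<ominus> c \<odot> y"
  by (simp add: minus_eq scale_add_right)

lemma is_subalgI:
  assumes "N \<subseteq> carrier A" "\<one> \<in> N"
    and "\<And>x y. x \<in> N \<Longrightarrow> y \<in> N \<Longrightarrow> x \<oplus> y \<in> N"
    and "\<And>x y. x \<in> N \<Longrightarrow> y \<in> N \<Longrightarrow> x \<otimes> y \<in> N"
    and scl: "\<And>c x. x \<in> N \<Longrightarrow> c \<odot> x \<in> N"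
  shows "is_subalg N A"
proof -
  have m: "\<ominus> x \<in> N" if "x \<in> N" for x
    using scl[OF that, of "-1"] that assms(1) by (simp add: minus_eq_scale subset_iff)
  have z: "\<zero> \<in> N"
    using scl[of \<one> 0] assms(2) by simp
  show ?thesis
    unfolding is_subalg_def
    by (intro conjI subringI submoduleI) (use assms m z in auto)
qed

lemma is_subalgD:
  assumes "is_subalg N A"
  shows "N \<subseteq> carrier A" "\<one> \<in> N" "\<zero> \<in> N"
    and "\<And>x y. x \<in> N \<Longrightarrow> y \<in> N \<Longrightarrow> x \<oplus> y \<in> N"
    and "\<And>x y. x \<in> N \<Longrightarrow> y \<in> N \<Longrightarrow> x \<otimes> y \<in> N"
    and "\<And>c x. x \<in> N \<Longrightarrow> c \<odot> x \<in> N"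
    and "\<And>x. x \<in> N \<Longrightarrow> \<ominus> x \<in> N"
  using assms subringE[of N A] submoduleE[of N] unfolding is_subalg_def
  by (auto simp: complex_ring_def)

lemma is_submoduleI:
  assumes "N \<subseteq> carrier A" "\<zero> \<in> N"
    and "\<And>x y. x \<in> N \<Longrightarrow> y \<in> N \<Longrightarrow> x \<oplus> y \<in> N"
    and scl: "\<And>c x. x \<in> N \<Longrightarrow> c \<odot> x \<in> N"
  shows "submodule N complex_ring A"
proof -
  have m: "\<ominus> x \<in> N" if "x \<in> N" for x
    using scl[OF that, of "-1"] that assms(1) by (simp add: minus_eq_scale subset_iff)
  show ?thesis by (intro submoduleI) (use assms m in auto)
qed

lemma is_submoduleD:
  assumes "submodule N complex_ring A"
  shows "N \<subseteq> carrier A" "\<zero> \<in> N"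
    and "\<And>x y. x \<in> N \<Longrightarrow> y \<in> N \<Longrightarrow> x \<oplus> y \<in> N"
    and "\<And>c x. x \<in> N \<Longrightarrow> c \<odot> x \<in> N"
proof -
  note E = submoduleE[OF assms]
  show sub: "N \<subseteq> carrier A"
    and "\<And>x y. x \<in> N \<Longrightarrow> y \<in> N \<Longrightarrow> x \<oplus> y \<in> N"
    and sc: "\<And>c x. x \<in> N \<Longrightarrow> c \<odot> x \<in> N"
    using E by (auto simp: complex_ring_def)
  obtain x where "x \<in> N" using E(2) by auto
  then show "\<zero> \<in> N" using sc[of x 0] sub by auto
qed

lemma generated_subalg_least:
  "is_subalg N A \<Longrightarrow> X \<subseteq> N \<Longrightarrow> generated_subalg A X \<subseteq> N"
  unfolding generated_subalg_def by auto

lemma generated_subalg_superset: "X \<subseteq> generated_subalg A X"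
  unfolding generated_subalg_def by auto

lemma is_subalg_carrier: "is_subalg (carrier A) A"
  by (rule is_subalgI) auto

lemma is_subalg_generated:
  assumes "X \<subseteq> carrier A"
  shows "is_subalg (generated_subalg A X) A"
  by (rule is_subalgI)
    (use generated_subalg_least[OF is_subalg_carrier assms] in
      \<open>auto simp: generated_subalg_def dest: is_subalgD\<close>)

lemma linear_span_least:
  "submodule N complex_ring A \<Longrightarrow> X \<subseteq> N \<Longrightarrow> linear_span A X \<subseteq> N"
  unfolding linear_span_def by auto

lemma linear_span_superset: "X \<subseteq> linear_span A X"
  unfolding linear_span_def by auto

lemma submodule_linear_span:
  assumes "X \<subseteq> carrier A"
  shows "submodule (linear_span A X) complex_ring A"
proof (rule is_submoduleI)
  have "submodule (carrier A) complex_ring A" by (rule is_submoduleI) auto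
  then show "linear_span A X \<subseteq> carrier A" using assms by (rule linear_span_least)
qed (auto simp: linear_span_def dest: is_submoduleD)

lemma linear_map_linear_span:
  assumes X: "X \<subseteq> carrier A" and N: "submodule N complex_ring A"
    and fc: "\<And>x. x \<in> carrier A \<Longrightarrow> f x \<in> carrier A"
    and add: "\<And>x y. x \<in> carrier A \<Longrightarrow> y \<in> carrier A \<Longrightarrow> f (x \<oplus> y) = f x \<oplus> f y"
    and scale: "\<And>c x. x \<in> carrier A \<Longrightarrow> f (c \<odot> x) = c \<odot> f x"
    and im: "\<And>x. x \<in> X \<Longrightarrow> f x \<in> N"
    and x: "x \<in> linear_span A X"
  shows "f x \<in> N"
proof -
  have f0: "f \<zero> = \<zero>" using scale[of \<zero> 0] fc[of \<zero>] by simp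
  have "submodule {x \<in> carrier A. f x \<in> N} complex_ring A"
    by (rule is_submoduleI) (use is_submoduleD[OF N] f0 in \<open>auto simp: add scale\<close>)
  then have "linear_span A X \<subseteq> {x \<in> carrier A. f x \<in> N}"
    by (rule linear_span_least) (use X im in auto)
  then show ?thesis using x by auto
qed

lemma is_subalg_centralizer:
  assumes "X \<subseteq> carrier A"
  shows "is_subalg {y \<in> carrier A. \<forall>x\<in>X. y \<otimes> x = x \<otimes> y} A"
proof (rule is_subalgI, goal_cases)
  case (4 a b)
  then have "(a \<otimes> b) \<otimes> x = x \<otimes> (a \<otimes> b)" if "x \<in> X" for x
    using that assms m_assoc[of a b x] m_assoc[of a x b] m_assoc[of x a b] by auto
  with 4 show ?case by auto
qed (use assms in \<open>auto simp: l_distr r_distr subset_iff smult_mult_left smult_mult_right\<close>)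

lemma monoid_subalg: "is_subalg N A \<Longrightarrow> Group.monoid (A\<lparr>carrier := N\<rparr>)"
  using subring_is_ring[of N] ring.axioms(2) unfolding is_subalg_def by blast

end

lemma alg_homI:
  assumes "\<And>x. x \<in> carrier A \<Longrightarrow> f x \<in> carrier B"
    and "\<And>x y. x \<in> carrier A \<Longrightarrow> y \<in> carrier A \<Longrightarrow> f (x \<otimes>\<^bsub>A\<^esub> y) = f x \<otimes>\<^bsub>B\<^esub> f y"
    and "\<And>x y. x \<in> carrier A \<Longrightarrow> y \<in> carrier A \<Longrightarrow> f (x \<oplus>\<^bsub>A\<^esub> y) = f x \<oplus>\<^bsub>B\<^esub> f y"
    and "f \<one>\<^bsub>A\<^esub> = \<one>\<^bsub>B\<^esub>"
    and "\<And>c x. x \<in> carrier A \<Longrightarrow> f (c \<odot>\<^bsub>A\<^esub> x) = c \<odot>\<^bsub>B\<^esub> f x"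
  shows "f \<in> alg_hom A B"
  using assms unfolding alg_hom_def ring_hom_def by auto

lemma alg_homD:
  assumes "f \<in> alg_hom A B"
  shows "\<And>x. x \<in> carrier A \<Longrightarrow> f x \<in> carrier B"
    and "\<And>x y. x \<in> carrier A \<Longrightarrow> y \<in> carrier A \<Longrightarrow> f (x \<otimes>\<^bsub>A\<^esub> y) = f x \<otimes>\<^bsub>B\<^esub> f y"
    and "\<And>x y. x \<in> carrier A \<Longrightarrow> y \<in> carrier A \<Longrightarrow> f (x \<oplus>\<^bsub>A\<^esub> y) = f x \<oplus>\<^bsub>B\<^esub> f y"
    and "f \<one>\<^bsub>A\<^esub> = \<one>\<^bsub>B\<^esub>"
    and "\<And>c x. x \<in> carrier A \<Longrightarrow> f (c \<odot>\<^bsub>A\<^esub> x) = c \<odot>\<^bsub>B\<^esub> f x"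
  using assms unfolding alg_hom_def ring_hom_def by auto

lemma alg_hom_comp:
  "f \<in> alg_hom A B \<Longrightarrow> g \<in> alg_hom B C \<Longrightarrow> (\<lambda>x. g (f x)) \<in> alg_hom A C"
  by (rule alg_homI) (auto simp: alg_homD)

lemma alg_hom_zero:
  assumes "complex_algebra A" "complex_algebra B" "f \<in> alg_hom A B"
  shows "f \<zero>\<^bsub>A\<^esub> = \<zero>\<^bsub>B\<^esub>"
proof -
  interpret A: complex_alg A using assms by (simp add: complex_alg_def)
  interpret B: complex_alg B using assms by (simp add: complex_alg_def)
  show ?thesis
    using alg_homD(5)[OF assms(3), of "\<zero>\<^bsub>A\<^esub>" 0] alg_homD(1)[OF assms(3), of "\<zero>\<^bsub>A\<^esub>"] by simp
qed

lemma is_subalg_image: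
  assumes "complex_algebra A" "complex_algebra B" "f \<in> alg_hom A B"
  shows "is_subalg (f ` carrier A) B"
proof -
  interpret A: complex_alg A using assms by (simp add: complex_alg_def)
  interpret B: complex_alg B using assms by (simp add: complex_alg_def)
  note f = alg_homD[OF assms(3)]
  show ?thesis
  proof (rule B.is_subalgI)
    show "\<one>\<^bsub>B\<^esub> \<in> f ` carrier A" using f(4) by (metis A.one_closed imageI)
  qed (auto simp: f(1) f(2,3,5)[symmetric])
qed

section \<open>Quotient algebras\<close>

lemma quotient_alg_sel [simp]:
  "carrier (quotient_alg A I) = a_rcosets\<^bsub>A\<^esub> I"
  "mult (quotient_alg A I) = rcoset_mult A I"
  "one (quotient_alg A I) = I +>\<^bsub>A\<^esub> \<one>\<^bsub>A\<^esub>"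
  "add (quotient_alg A I) = set_add A"
  "smult (quotient_alg A I) = (\<lambda>c X. \<Union>x\<in>X. I +>\<^bsub>A\<^esub> (c \<odot>\<^bsub>A\<^esub> x))"
  by (simp_all add: quotient_alg_def FactRing_def)

context complex_alg
begin

text \<open>Because \<open>c x = (c 1) x\<close> in a unital algebra.\<close>

lemma ideal_scale:
  assumes "ideal I A" "x \<in> I"
  shows "c \<odot> x \<in> I"
proof -
  interpret ideal I A by fact
  have "(c \<odot> \<one>) \<otimes> x \<in> I" using assms by (intro I_l_closed) auto
  then show ?thesis using assms by (simp add: smult_mult_left)
qed

lemma coset_eq_iff:
  assumes "ideal I A" "x \<in> carrier A" "y \<in> carrier A"
  shows "I +> x = I +> y \<longleftrightarrow> x \<ominus> y \<in> I"
proof -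
  interpret ideal I A by fact
  show ?thesis
    using assms a_rcos_self a_repr_independence' a_rcos_module_minus[OF ring_axioms]
      a_subgroup by metis
qed

text \<open>The scalar multiple of a coset is a union of cosets, one for each representative. They all agree
because ideals are stable under scalars.\<close>

lemma coset_hom:
  assumes "ideal I A"
  shows "(\<lambda>x. I +> x) \<in> alg_hom A (quotient_alg A I)"
proof (rule alg_homI)
  interpret ideal I A by fact
  fix c x y assume x: "x \<in> carrier A"
  then show "I +> x \<in> carrier (quotient_alg A I)"
    using a_rcosetsI[OF a_subset] by simp
  have "I +> (c \<odot> y) = I +> (c \<odot> x)" if "y \<in> I +> x" for y
  proof -
    have y: "y \<in> carrier A" using that x a_elemrcos_carrier by blast
    have "y \<ominus> x \<in> I" using that x y a_rcos_module_minus[OF ring_axioms] by blast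
    then have "c \<odot> y \<ominus> c \<odot> x \<in> I"
      using ideal_scale[OF assms, of "y \<ominus> x" c] x y by (simp add: scale_diff_right)
    then show ?thesis using coset_eq_iff[OF assms] x y by auto
  qed
  moreover have "I +> x \<noteq> {}" using a_rcos_self x by blast
  ultimately show "I +> (c \<odot> x) = c \<odot>\<^bsub>quotient_alg A I\<^esub> (I +> x)"
    by (simp add: SUP_eq_const)
  assume y: "y \<in> carrier A"
  show "I +> x \<otimes> y = (I +> x) \<otimes>\<^bsub>quotient_alg A I\<^esub> (I +> y)"
    using x y by (simp add: rcoset_mult_add)
  show "I +> x \<oplus> y = (I +> x) \<oplus>\<^bsub>quotient_alg A I\<^esub> (I +> y)"
    using x y by (simp add: a_rcos_sum)
qed simp

lemma quotient_carrierE: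
  assumes "X \<in> carrier (quotient_alg A I)"
  obtains x where "x \<in> carrier A" "X = I +> x"
  using assms by (auto simp: A_RCOSETS_def RCOSETS_def a_r_coset_def)

end

lemma ideal_kernel:
  assumes A: "complex_algebra A" and B: "complex_algebra B" and f: "f \<in> alg_hom A B"
  shows "ideal {x \<in> carrier A. f x = \<zero>\<^bsub>B\<^esub>} A"
proof -
  interpret A: complex_alg A using assms by (simp add: complex_alg_def)
  interpret B: complex_alg B using assms by (simp add: complex_alg_def)
  note fD = alg_homD[OF f] and f0 = alg_hom_zero[OF A B f]
  have "subgroup {x \<in> carrier A. f x = \<zero>\<^bsub>B\<^esub>} (add_monoid A)"
  proof (rule A.add.subgroupI)
    fix a assume "a \<in> {x \<in> carrier A. f x = \<zero>\<^bsub>B\<^esub>}"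
    then show "\<ominus>\<^bsub>A\<^esub> a \<in> {x \<in> carrier A. f x = \<zero>\<^bsub>B\<^esub>}"
      using fD(5)[of a "-1"] A.minus_eq_scale[of a] by auto
  qed (use f0 fD in auto)
  then show ?thesis
    by (intro idealI) (auto simp: fD A.ring_axioms)
qed

lemma induced_hom:
  assumes A: "complex_algebra A" and B: "complex_algebra B" and I: "ideal I A"
    and f: "f \<in> alg_hom A B" and f0: "\<And>x. x \<in> I \<Longrightarrow> f x = \<zero>\<^bsub>B\<^esub>"
  obtains g where "g \<in> alg_hom (quotient_alg A I) B"
    and "\<And>x. x \<in> carrier A \<Longrightarrow> g (I +>\<^bsub>A\<^esub> x) = f x"
proof -
  interpret A: complex_alg A using assms by (simp add: complex_alg_def)
  interpret B: complex_alg B using assms by (simp add: complex_alg_def)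
  interpret I: ideal I A by fact
  note fD = alg_homD[OF f]
  define g where "g X = f (SOME x. x \<in> X)" for X
  have g: "g (I +>\<^bsub>A\<^esub> x) = f x" if x: "x \<in> carrier A" for x
  proof -
    have "(SOME y. y \<in> I +>\<^bsub>A\<^esub> x) \<in> I +>\<^bsub>A\<^esub> x"
      using I.a_rcos_self[OF x] by (rule someI)
    then obtain i where i: "i \<in> I" "(SOME y. y \<in> I +>\<^bsub>A\<^esub> x) = i \<oplus>\<^bsub>A\<^esub> x"
      by (auto simp: a_r_coset_def r_coset_def)
    then show ?thesis using x fD f0 I.a_subset by (auto simp: g_def subset_iff)
  qed
  have "g \<in> alg_hom (quotient_alg A I) B"
  proof -
    note q = alg_homD[OF A.coset_hom[OF I]]
    show ?thesis
    proof (rule alg_homI)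
      fix c X Y assume X: "X \<in> carrier (quotient_alg A I)"
      then obtain x where x: "x \<in> carrier A" "X = I +>\<^bsub>A\<^esub> x"
        by (rule A.quotient_carrierE)
      show "g X \<in> carrier B" using x g fD by auto
      show "g (c \<odot>\<^bsub>quotient_alg A I\<^esub> X) = c \<odot>\<^bsub>B\<^esub> g X"
        using x g fD q(5)[of x c, symmetric] A.scale_closed[of x c] by metis
      assume Y: "Y \<in> carrier (quotient_alg A I)"
      then obtain y where y: "y \<in> carrier A" "Y = I +>\<^bsub>A\<^esub> y"
        by (rule A.quotient_carrierE)
      show "g (X \<otimes>\<^bsub>quotient_alg A I\<^esub> Y) = g X \<otimes>\<^bsub>B\<^esub> g Y"
        using x y g fD q(2)[of x y, symmetric] A.m_closed by metis
      show "g (X \<oplus>\<^bsub>quotient_alg A I\<^esub> Y) = g X \<oplus>\<^bsub>B\<^esub> g Y"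
        using x y g fD q(3)[of x y, symmetric] A.a_closed by metis
    next
      show "g \<one>\<^bsub>quotient_alg A I\<^esub> = \<one>\<^bsub>B\<^esub>" using g fD by auto
    qed
  qed
  with g show ?thesis by (intro that)
qed

section \<open>Monoid algebras\<close>

lemma monoid_alg_sel [simp]:
  "carrier (monoid_alg M) = {f. Poly_Mapping.keys f \<subseteq> carrier M}"
  "one (monoid_alg M) = Poly_Mapping.single \<one>\<^bsub>M\<^esub> 1"
  "zero (monoid_alg M) = 0"
  "add (monoid_alg M) = (+)"
  "smult (monoid_alg M) = (\<lambda>c f. Poly_Mapping.map ((*) c) f)"
  by (simp_all add: monoid_alg_def)

lemma lookup_map_times [simp]: "Poly_Mapping.lookup (Poly_Mapping.map ((*) c) f) x = c * Poly_Mapping.lookup f (x::'a) "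
  for c :: complex
  by (simp add: Poly_Mapping.map.rep_eq when_def)

lemma sum_single_lookup:
  assumes "finite X" "Poly_Mapping.keys f \<subseteq> X"
  shows "(\<Sum>x\<in>X. Poly_Mapping.single x (Poly_Mapping.lookup f x)) = f"
proof (rule poly_mapping_eqI)
  fix k
  have "(\<Sum>x\<in>X. Poly_Mapping.lookup f x when x = k) = Poly_Mapping.lookup f k"
    using assms by (cases "k \<in> X") (auto simp: when_def in_keys_iff)
  then show "Poly_Mapping.lookup (\<Sum>x\<in>X. Poly_Mapping.single x (Poly_Mapping.lookup f x)) k
      = Poly_Mapping.lookup f k"
    by (simp add: lookup_sum lookup_single)
qed

text \<open>Reduces additive statements about a monoid algebra to its basis vectors.\<close>

lemma poly_mapping_induct_on [consumes 1, case_names zero single add]: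
  fixes f :: "'a \<Rightarrow>\<^sub>0 'b::comm_monoid_add"
  assumes "Poly_Mapping.keys f \<subseteq> X"
    and "P 0"
    and "\<And>x c. x \<in> X \<Longrightarrow> P (Poly_Mapping.single x c)"
    and "\<And>f g. Poly_Mapping.keys f \<subseteq> X \<Longrightarrow> Poly_Mapping.keys g \<subseteq> X \<Longrightarrow> P f \<Longrightarrow> P g \<Longrightarrow> P (f + g)"
  shows "P f"
proof -
  have "Poly_Mapping.keys (\<Sum>x\<in>Y. Poly_Mapping.single x (Poly_Mapping.lookup f x)) \<subseteq> X
      \<and> P (\<Sum>x\<in>Y. Poly_Mapping.single x (Poly_Mapping.lookup f x))"
    if "finite Y" "Y \<subseteq> X" for Y
    using that
  proof induction
    case (insert y Y)
    have "Poly_Mapping.keys (Poly_Mapping.single y (Poly_Mapping.lookup f y)) \<subseteq> X"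
      using insert.prems by auto
    then show ?case
      using insert assms(3)[of y]
      by (auto simp del: keys_single intro!: assms(4) dest!: keys_add[THEN subsetD])
  qed (use assms in auto)
  from this[of "Poly_Mapping.keys f"] show ?thesis
    using sum_single_lookup[of "Poly_Mapping.keys f" f] assms(1) by simp
qed

text \<open>Index sets larger than the supports only contribute zero terms. Factors with different supports can
then be compared termwise over a common index set.\<close>

lemma monoid_alg_mult:
  assumes "finite X" "finite Y" "Poly_Mapping.keys f \<subseteq> X" "Poly_Mapping.keys g \<subseteq> Y"
  shows "f \<otimes>\<^bsub>monoid_alg M\<^esub> g = (\<Sum>x\<in>X. \<Sum>y\<in>Y. Poly_Mapping.single (x \<otimes>\<^bsub>M\<^esub> y)
    (Poly_Mapping.lookup f x * Poly_Mapping.lookup g y))"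
proof -
  have "f \<otimes>\<^bsub>monoid_alg M\<^esub> g = (\<Sum>x\<in>Poly_Mapping.keys f. \<Sum>y\<in>Y. Poly_Mapping.single (x \<otimes>\<^bsub>M\<^esub> y)
    (Poly_Mapping.lookup f x * Poly_Mapping.lookup g y))"
    unfolding monoid_alg_def monoid.select_convs
    by (intro sum.cong refl sum.mono_neutral_left) (use assms in \<open>auto simp: in_keys_iff\<close>)
  also have "\<dots> = (\<Sum>x\<in>X. \<Sum>y\<in>Y. Poly_Mapping.single (x \<otimes>\<^bsub>M\<^esub> y)
    (Poly_Mapping.lookup f x * Poly_Mapping.lookup g y))"
    by (intro sum.mono_neutral_left) (use assms in \<open>auto simp: in_keys_iff\<close>)
  finally show ?thesis .
qed

lemma monoid_alg_mult_single [simp]: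
  "Poly_Mapping.single x c \<otimes>\<^bsub>monoid_alg M\<^esub> Poly_Mapping.single y d
    = Poly_Mapping.single (x \<otimes>\<^bsub>M\<^esub> y) (c * d)"
  using monoid_alg_mult[of "{x}" "{y}" "Poly_Mapping.single x c" "Poly_Mapping.single y d" M]
  by simp

lemma monoid_alg_mult_zero [simp]:
  "0 \<otimes>\<^bsub>monoid_alg M\<^esub> f = 0" "f \<otimes>\<^bsub>monoid_alg M\<^esub> 0 = 0"
  by (simp_all add: monoid_alg_def)

lemma monoid_alg_distrib:
  "(f + g) \<otimes>\<^bsub>monoid_alg M\<^esub> h = f \<otimes>\<^bsub>monoid_alg M\<^esub> h + g \<otimes>\<^bsub>monoid_alg M\<^esub> h"
  "h \<otimes>\<^bsub>monoid_alg M\<^esub> (f + g) = h \<otimes>\<^bsub>monoid_alg M\<^esub> f + h \<otimes>\<^bsub>monoid_alg M\<^esub> g"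
proof -
  let ?X = "Poly_Mapping.keys f \<union> Poly_Mapping.keys g" and ?Y = "Poly_Mapping.keys h"
  have X: "finite ?X" "Poly_Mapping.keys (f + g) \<subseteq> ?X" "Poly_Mapping.keys f \<subseteq> ?X"
    "Poly_Mapping.keys g \<subseteq> ?X" "finite ?Y" "?Y \<subseteq> ?Y"
    by (auto dest!: keys_add[THEN subsetD])
  show "(f + g) \<otimes>\<^bsub>monoid_alg M\<^esub> h = f \<otimes>\<^bsub>monoid_alg M\<^esub> h + g \<otimes>\<^bsub>monoid_alg M\<^esub> h"
    by (subst (1 2 3) monoid_alg_mult[of ?X ?Y])
       (use X in \<open>auto simp: lookup_add distrib_right single_add sum.distrib\<close>)
  show "h \<otimes>\<^bsub>monoid_alg M\<^esub> (f + g) = h \<otimes>\<^bsub>monoid_alg M\<^esub> f + h \<otimes>\<^bsub>monoid_alg M\<^esub> g"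
    by (subst (1 2 3) monoid_alg_mult[of ?Y ?X])
       (use X in \<open>auto simp: lookup_add distrib_left single_add sum.distrib\<close>)
qed

lemma map_times_add: "Poly_Mapping.map ((*) c) (f + g) = Poly_Mapping.map ((*) c) f + Poly_Mapping.map ((*) c) g"
  for c :: complex
  by (rule poly_mapping_eqI) (simp add: lookup_add distrib_left)

lemma map_times_single [simp]: "Poly_Mapping.map ((*) c) (Poly_Mapping.single x d) = Poly_Mapping.single x (c * d)"
  for c :: complex
  by (rule poly_mapping_eqI) (simp add: lookup_single when_def)

lemma map_times_zero [simp]: "Poly_Mapping.map ((*) c) 0 = 0"
  for c :: complex
  by (rule poly_mapping_eqI) simp

lemma keys_map_times: "Poly_Mapping.keys (Poly_Mapping.map ((*) c) f) \<subseteq> Poly_Mapping.keys f"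
  for c :: complex
  by (auto simp: in_keys_iff)

text \<open>Each axiom is additive in every argument, so it follows from the monoid laws on basis vectors.\<close>

lemma complex_algebra_monoid_alg:
  assumes "Group.monoid M"
  shows "complex_algebra (monoid_alg M)"
proof -
  interpret Group.monoid M by fact
  let ?F = "monoid_alg M"
  note dist = monoid_alg_distrib
  have closed: "f \<otimes>\<^bsub>?F\<^esub> g \<in> carrier ?F" if f: "Poly_Mapping.keys f \<subseteq> carrier M" and g: "Poly_Mapping.keys g \<subseteq> carrier M" for f g
    using f
  proof (induction f rule: poly_mapping_induct_on)
    case (single x c)
    show ?case using g
      by (induction g rule: poly_mapping_induct_on)
        (use single in \<open>auto simp: dist dest!: keys_add[THEN subsetD]\<close>)
  qed (auto simp: dist dest!: keys_add[THEN subsetD])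
  have assoc: "(f \<otimes>\<^bsub>?F\<^esub> g) \<otimes>\<^bsub>?F\<^esub> h = f \<otimes>\<^bsub>?F\<^esub> (g \<otimes>\<^bsub>?F\<^esub> h)"
    if f: "Poly_Mapping.keys f \<subseteq> carrier M" and g: "Poly_Mapping.keys g \<subseteq> carrier M"
      and h: "Poly_Mapping.keys h \<subseteq> carrier M" for f g h
    using f
  proof (induction f rule: poly_mapping_induct_on)
    case (single x c)
    show ?case using g
    proof (induction g rule: poly_mapping_induct_on)
      case (single y d)
      show ?case using h
        by (induction h rule: poly_mapping_induct_on)
          (use single \<open>x \<in> carrier M\<close> in \<open>auto simp: dist m_assoc mult.assoc\<close>)
    qed (auto simp: dist)
  qed (auto simp: dist)
  have one: "Poly_Mapping.single \<one>\<^bsub>M\<^esub> 1 \<otimes>\<^bsub>?F\<^esub> f = f" "f \<otimes>\<^bsub>?F\<^esub> Poly_Mapping.single \<one>\<^bsub>M\<^esub> 1 = f"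
    if f: "Poly_Mapping.keys f \<subseteq> carrier M" for f
    using f by (induction f rule: poly_mapping_induct_on) (auto simp: dist)
  have scale: "(Poly_Mapping.map ((*) c) f) \<otimes>\<^bsub>?F\<^esub> g = Poly_Mapping.map ((*) c) (f \<otimes>\<^bsub>?F\<^esub> g)"
     "f \<otimes>\<^bsub>?F\<^esub> (Poly_Mapping.map ((*) c) g) = Poly_Mapping.map ((*) c) (f \<otimes>\<^bsub>?F\<^esub> g)" for f g c
  proof -
    have f: "Poly_Mapping.keys f \<subseteq> UNIV" and g: "Poly_Mapping.keys g \<subseteq> UNIV" by auto
    show "(Poly_Mapping.map ((*) c) f) \<otimes>\<^bsub>?F\<^esub> g = Poly_Mapping.map ((*) c) (f \<otimes>\<^bsub>?F\<^esub> g)"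
      using f
    proof (induction f rule: poly_mapping_induct_on)
      case (single x d)
      show ?case using g
        by (induction g rule: poly_mapping_induct_on) (auto simp: dist map_times_add mult.assoc)
    qed (auto simp: dist map_times_add)
    show "f \<otimes>\<^bsub>?F\<^esub> (Poly_Mapping.map ((*) c) g) = Poly_Mapping.map ((*) c) (f \<otimes>\<^bsub>?F\<^esub> g)"
      using f
    proof (induction f rule: poly_mapping_induct_on)
      case (single x d)
      show ?case using g
        by (induction g rule: poly_mapping_induct_on) (auto simp: dist map_times_add mult.left_commute)
    qed (auto simp: dist map_times_add)
  qed
  show ?thesis
  proof (rule complex_algebraI)
    show "ring ?F"
    proof (rule ringI)
      show "abelian_group ?F"
      proof (rule abelian_groupI)
        fix f assume "f \<in> carrier ?F"
        then show "\<exists>y\<in>carrier ?F. y \<oplus>\<^bsub>?F\<^esub> f = \<zero>\<^bsub>?F\<^esub>"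
          by (intro bexI[of _ "- f"]) auto
      qed (auto simp: ac_simps dest!: keys_add[THEN subsetD])
      show "Group.monoid ?F"
        by (rule monoidI) (use closed assoc one in auto)
    qed (auto simp: dist)
  qed (auto simp: scale map_times_add distrib_right keys_map_times[THEN subsetD] lookup_add
      intro!: poly_mapping_eqI)
qed

definition (in complex_alg) lift_monoid :: "('m \<Rightarrow> 'a) \<Rightarrow> ('m \<Rightarrow>\<^sub>0 complex) \<Rightarrow> 'a"
  where "lift_monoid g f = (\<Oplus>x\<in>Poly_Mapping.keys f. Poly_Mapping.lookup f x \<odot> g x)"

lemma (in complex_alg) lift_monoid_eq:
  assumes "finite X" "Poly_Mapping.keys f \<subseteq> X" "g \<in> X \<rightarrow> carrier A"
  shows "lift_monoid g f = (\<Oplus>x\<in>X. Poly_Mapping.lookup f x \<odot> g x)"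
  unfolding lift_monoid_def
  by (rule add.finprod_mono_neutral_cong_left) (use assms in \<open>auto simp: in_keys_iff Pi_iff\<close>)

lemma (in complex_alg) lift_monoid_single:
  "g x \<in> carrier A \<Longrightarrow> lift_monoid g (Poly_Mapping.single x c) = c \<odot> g x"
  using lift_monoid_eq[of "{x}" "Poly_Mapping.single x c" g] finsum_singleton[of x "{x}" "\<lambda>x. c \<odot> g x"]
  by (auto simp: finsum_insert)

text \<open>The universal property of the monoid algebra.\<close>

lemma (in complex_alg) lift_monoid_hom:
  assumes M: "Group.monoid M"
    and g: "\<And>x. x \<in> carrier M \<Longrightarrow> g x \<in> carrier A"
    and g_mult: "\<And>x y. x \<in> carrier M \<Longrightarrow> y \<in> carrier M \<Longrightarrow> g (x \<otimes>\<^bsub>M\<^esub> y) = g x \<otimes> g y"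
    and g_one: "g \<one>\<^bsub>M\<^esub> = \<one>"
  shows "lift_monoid g \<in> alg_hom (monoid_alg M) A"
proof -
  interpret M: Group.monoid M by fact
  note F = complex_algebra_monoid_alg[OF M]
  interpret F: complex_alg "monoid_alg M" using F by (simp add: complex_alg_def)
  let ?L = "lift_monoid g"
  have closed: "?L f \<in> carrier A" if "Poly_Mapping.keys f \<subseteq> carrier M" for f
    using that g by (auto simp: lift_monoid_def intro!: finsum_closed)
  have hom_add: "?L (f + h) = ?L f \<oplus> ?L h"
    if fh: "Poly_Mapping.keys f \<subseteq> carrier M" "Poly_Mapping.keys h \<subseteq> carrier M" for f h
  proof -
    let ?X = "Poly_Mapping.keys f \<union> Poly_Mapping.keys h"
    have gX: "g \<in> ?X \<rightarrow> carrier A" using fh g by auto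
    have "?L (f + h) = (\<Oplus>x\<in>?X. Poly_Mapping.lookup (f + h) x \<odot> g x)"
      by (rule lift_monoid_eq) (use gX in \<open>auto dest!: keys_add[THEN subsetD]\<close>)
    also have "\<dots> = (\<Oplus>x\<in>?X. Poly_Mapping.lookup f x \<odot> g x \<oplus> Poly_Mapping.lookup h x \<odot> g x)"
      by (rule finsum_cong') (use gX in \<open>auto simp: lookup_add scale_add_left Pi_iff\<close>)
    also have "\<dots> = (\<Oplus>x\<in>?X. Poly_Mapping.lookup f x \<odot> g x) \<oplus> (\<Oplus>x\<in>?X. Poly_Mapping.lookup h x \<odot> g x)"
      by (rule finsum_addf) (use gX in auto)
    also have "\<dots> = ?L f \<oplus> ?L h"
      by (subst (1 2) lift_monoid_eq[of ?X]) (use gX in auto)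
    finally show ?thesis .
  qed
  have sing: "?L (Poly_Mapping.single x c) = c \<odot> g x" if "x \<in> carrier M" for x c
    using that g by (simp add: lift_monoid_single)
  have zero: "?L 0 = \<zero>" by (simp add: lift_monoid_def)
  note closedF = F.m_closed[simplified]
  have mult: "?L (f \<otimes>\<^bsub>monoid_alg M\<^esub> h) = ?L f \<otimes> ?L h"
    if f: "Poly_Mapping.keys f \<subseteq> carrier M" and h: "Poly_Mapping.keys h \<subseteq> carrier M" for f h
    using f
  proof (induction f rule: poly_mapping_induct_on)
    case (single x c)
    have kx: "Poly_Mapping.keys (Poly_Mapping.single x c) \<subseteq> carrier M" using single by auto
    show ?case using h
    proof (induction h rule: poly_mapping_induct_on)
      case (single y d)
      then show ?case using \<open>x \<in> carrier M\<close> g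
        by (simp add: sing g_mult smult_mult_left smult_mult_right mult.commute)
    next
      case (add h1 h2)
      then show ?case using kx closedF[OF kx]
        by (simp add: monoid_alg_distrib hom_add closedF closed r_distr)
    qed (simp add: zero closed[OF kx])
  next
    case (add f1 f2)
    then show ?case using h
      by (simp add: monoid_alg_distrib hom_add closedF closed l_distr)
  qed (simp add: zero closed[OF h])
  have scale: "?L (Poly_Mapping.map ((*) c) f) = c \<odot> ?L f" if "Poly_Mapping.keys f \<subseteq> carrier M" for f c
    using that
  proof (induction f rule: poly_mapping_induct_on)
    case (add f1 f2)
    then have "Poly_Mapping.keys (Poly_Mapping.map ((*) c) f1) \<subseteq> carrier M"
      "Poly_Mapping.keys (Poly_Mapping.map ((*) c) f2) \<subseteq> carrier M"
      by (simp_all add: order_trans[OF keys_map_times])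
    with add show ?case by (simp add: map_times_add hom_add closed scale_add_right)
  qed (auto simp: zero sing g)
  show ?thesis
    by (rule alg_homI) (use closed mult hom_add scale sing[of "\<one>\<^bsub>M\<^esub>" 1] g_one in auto)
qed

lemma monoid_alg_minus:
  assumes "Group.monoid M" "f \<in> carrier (monoid_alg M)" "g \<in> carrier (monoid_alg M)"
  shows "f \<ominus>\<^bsub>monoid_alg M\<^esub> g = f - g"
proof -
  interpret F: complex_alg "monoid_alg M"
    using complex_algebra_monoid_alg[OF assms(1)] by (simp add: complex_alg_def)
  have "\<ominus>\<^bsub>monoid_alg M\<^esub> g = - g"
    by (rule F.minus_equality) (use assms in auto)
  then show ?thesis by (simp add: F.minus_eq)
qed

lemma monoid_alg_ideal_closed:
  assumes "ideal I (monoid_alg M)"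
  shows "0 \<in> I" "\<And>f g. f \<in> I \<Longrightarrow> g \<in> I \<Longrightarrow> f + g \<in> I" "\<And>f g. f \<in> I \<Longrightarrow> g \<in> I \<Longrightarrow> f - g \<in> I"
proof -
  interpret I: ideal I "monoid_alg M" by fact
  have M: "\<ominus>\<^bsub>monoid_alg M\<^esub> g = - g" if "g \<in> I" for g
    by (rule I.minus_equality) (use that I.a_subset in auto)
  note sub = I.is_additive_subgroup
  show "0 \<in> I" using additive_subgroup.zero_closed[OF sub] by simp
  show a: "f + g \<in> I" if "f \<in> I" "g \<in> I" for f g using additive_subgroup.a_closed[OF sub that] by simp
  show "f - g \<in> I" if "f \<in> I" "g \<in> I" for f g
    using a[OF that(1), of "- g"] additive_subgroup.a_inv_closed[OF sub that(2)] M[OF that(2)] by simp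
qed

lemma monoid_alg_coset_eqI:
  assumes "Group.monoid M" "ideal I (monoid_alg M)"
    and "f \<in> carrier (monoid_alg M)" "g \<in> carrier (monoid_alg M)" "f - g \<in> I"
  shows "I +>\<^bsub>monoid_alg M\<^esub> f = I +>\<^bsub>monoid_alg M\<^esub> g"
proof -
  interpret F: complex_alg "monoid_alg M"
    using complex_algebra_monoid_alg[OF assms(1)] by (simp add: complex_alg_def)
  show ?thesis using F.coset_eq_iff[OF assms(2-4)] monoid_alg_minus[OF assms(1,3,4)] assms(5) by simp
qed

section \<open>Commutators\<close>

context complex_alg
begin

abbreviation ad :: "'a \<Rightarrow> 'a \<Rightarrow> 'a" where "ad \<equiv> commutator A"

lemma ad_closed [simp, intro]: "x \<in> carrier A \<Longrightarrow> y \<in> carrier A \<Longrightarrow> ad x y \<in> carrier A"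
  by (simp add: commutator_def)

lemma ad_add [simp]: "x \<in> carrier A \<Longrightarrow> y \<in> carrier A \<Longrightarrow> z \<in> carrier A \<Longrightarrow>
    ad x (y \<oplus> z) = ad x y \<oplus> ad x z"
  unfolding commutator_def by algebra

lemma ad_scale [simp]: "x \<in> carrier A \<Longrightarrow> y \<in> carrier A \<Longrightarrow> ad x (c \<odot> y) = c \<odot> ad x y"
  by (simp add: commutator_def scale_diff_right smult_mult_left smult_mult_right)

lemma ad_minus [simp]: "x \<in> carrier A \<Longrightarrow> y \<in> carrier A \<Longrightarrow> ad x (\<ominus> y) = \<ominus> ad x y"
  by (simp add: minus_eq_scale)

lemma ad_diff [simp]: "x \<in> carrier A \<Longrightarrow> y \<in> carrier A \<Longrightarrow> z \<in> carrier A \<Longrightarrow>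
    ad x (y \<ominus> z) = ad x y \<ominus> ad x z"
  by (simp add: minus_eq)

lemma ad_zero [simp]: "x \<in> carrier A \<Longrightarrow> ad x \<zero> = \<zero>"
  by (simp add: commutator_def minus_eq)

lemma ad_one [simp]: "x \<in> carrier A \<Longrightarrow> ad x \<one> = \<zero>"
  by (simp add: commutator_def minus_eq r_neg)

lemma ad_self [simp]: "x \<in> carrier A \<Longrightarrow> ad x x = \<zero>"
  by (simp add: commutator_def minus_eq r_neg)

lemma ad_antisym: "x \<in> carrier A \<Longrightarrow> y \<in> carrier A \<Longrightarrow> ad y x = \<ominus> ad x y"
  unfolding commutator_def by algebra

lemma ad_mult: "x \<in> carrier A \<Longrightarrow> y \<in> carrier A \<Longrightarrow> z \<in> carrier A \<Longrightarrow>
    ad x (y \<otimes> z) = ad x y \<otimes> z \<oplus> y \<otimes> ad x z"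
  unfolding commutator_def by algebra

lemma ad_jacobi: "x \<in> carrier A \<Longrightarrow> y \<in> carrier A \<Longrightarrow> z \<in> carrier A \<Longrightarrow>
    ad x (ad y z) = ad (ad x y) z \<oplus> ad y (ad x z)"
  unfolding commutator_def by algebra

lemma ad_eq_zero_iff:
  "x \<in> carrier A \<Longrightarrow> y \<in> carrier A \<Longrightarrow> ad x y = \<zero> \<longleftrightarrow> x \<otimes> y = y \<otimes> x"
  unfolding commutator_def by simp

lemma ad_zero_sym: "x \<in> carrier A \<Longrightarrow> y \<in> carrier A \<Longrightarrow> ad x y = \<zero> \<Longrightarrow> ad y x = \<zero>"
  by (simp add: ad_eq_zero_iff)

lemma ad_zero_lcomm:
  "ad x y = \<zero> \<Longrightarrow> x \<in> carrier A \<Longrightarrow> y \<in> carrier A \<Longrightarrow> z \<in> carrier A \<Longrightarrow> x \<otimes> (y \<otimes> z) = y \<otimes> (x \<otimes> z)"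
  using m_assoc[of x y z] m_assoc[of y x z] by (simp add: ad_eq_zero_iff)

lemma ad_scale_left: "x \<in> carrier A \<Longrightarrow> y \<in> carrier A \<Longrightarrow> ad (c \<odot> x) y = c \<odot> ad x y"
  by (simp add: commutator_def scale_diff_right smult_mult_left smult_mult_right)

lemma ad_commute:
  "x \<in> carrier A \<Longrightarrow> y \<in> carrier A \<Longrightarrow> z \<in> carrier A \<Longrightarrow> ad x y = \<zero> \<Longrightarrow> ad x (ad y z) = ad y (ad x z)"
  using ad_jacobi[of x y z] ad_antisym[of z \<zero>] by simp

lemma mult_swap_ad:
  "x \<in> carrier A \<Longrightarrow> y \<in> carrier A \<Longrightarrow> x \<otimes> y = y \<otimes> x \<oplus> ad x y"
  unfolding commutator_def by algebra

lemma inv_mult_units: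
  "x \<in> Units A \<Longrightarrow> y \<in> Units A \<Longrightarrow> inv (x \<otimes> y) = inv y \<otimes> inv x"
  using group.inv_mult_group[OF units_group, of x y]
  by (simp add: units_of_carrier units_of_mult units_of_inv)

lemma ad_inv:
  assumes x: "x \<in> carrier A" and u: "u \<in> Units A"
  shows "ad x (inv u) = \<ominus> (inv u \<otimes> (ad x u \<otimes> inv u))"
proof -
  have c: "u \<in> carrier A" "inv u \<in> carrier A" using u by auto
  have "inv u \<otimes> (ad x (u \<otimes> inv u)) = \<zero>" using u x c by simp
  also have "ad x (u \<otimes> inv u) = ad x u \<otimes> inv u \<oplus> u \<otimes> ad x (inv u)"
    using x c by (simp add: ad_mult)
  also have "inv u \<otimes> (ad x u \<otimes> inv u \<oplus> u \<otimes> ad x (inv u))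
      = inv u \<otimes> (ad x u \<otimes> inv u) \<oplus> (inv u \<otimes> u) \<otimes> ad x (inv u)"
    using x c by (simp add: r_distr m_assoc)
  finally have "ad x (inv u) \<oplus> inv u \<otimes> (ad x u \<otimes> inv u) = \<zero>" using x c u by (simp add: a_comm)
  then show ?thesis using x c minus_equality by (metis ad_closed m_closed)
qed

lemma ad_finsum:
  assumes "finite S" "x \<in> carrier A" "\<And>i. i \<in> S \<Longrightarrow> v i \<in> carrier A"
  shows "ad x (\<Oplus>i\<in>S. v i) = (\<Oplus>i\<in>S. ad x (v i))"
  using assms by (induction S) (auto simp: Pi_iff)

lemma scale_finsum:
  assumes "finite S" "\<And>i. i \<in> S \<Longrightarrow> v i \<in> carrier A"
  shows "c \<odot> (\<Oplus>i\<in>S. v i) = (\<Oplus>i\<in>S. c \<odot> v i)"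
  using assms by (induction S) (auto simp: Pi_iff scale_add_right)

lemma ad_nat_pow_eq_zero:
  assumes "x \<in> carrier A" "y \<in> carrier A" "ad x y = \<zero>"
  shows "ad x (y [^] (k::nat)) = \<zero>"
  using assms by (induction k) (auto simp: ad_mult)

lemma ad_nat_pow:
  assumes "x \<in> carrier A" "y \<in> carrier A" "ad x y = \<one>"
  shows "ad x (y [^] (k::nat)) = of_nat k \<odot> y [^] (k - 1)"
proof (induction k)
  case (Suc k)
  have *: "of_nat k \<odot> y [^] (k - 1) \<otimes> y = of_nat k \<odot> y [^] k"
    using assms(2) by (cases k) (auto simp: smult_mult_left)
  show ?case using assms Suc by (simp add: ad_mult * scale_add_left a_comm del: One_nat_def)
qed (use assms in simp)

definition zpow :: "'a \<Rightarrow> int \<Rightarrow> 'a" where "zpow u a = u [^]\<^bsub>units_of A\<^esub> a"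

lemma zpow_Units: "u \<in> Units A \<Longrightarrow> zpow u a \<in> Units A"
  using group.int_pow_closed[OF units_group, of u a] by (simp add: zpow_def units_of_carrier)

lemma zpow_closed [simp, intro]: "u \<in> Units A \<Longrightarrow> zpow u a \<in> carrier A"
  using zpow_Units by blast

lemma zpow_0 [simp]: "zpow u 0 = \<one>"
  by (simp add: zpow_def units_of_one)

lemma zpow_add: "u \<in> Units A \<Longrightarrow> zpow u (a + b) = zpow u a \<otimes> zpow u b"
  using group.int_pow_mult[OF units_group, of u a b] by (simp add: zpow_def units_of_carrier units_of_mult)

lemma zpow_1 [simp]: "u \<in> Units A \<Longrightarrow> zpow u 1 = u"
  using group.int_pow_1[OF units_group, of u] by (simp add: zpow_def units_of_carrier)

lemma zpow_m1 [simp]: "u \<in> Units A \<Longrightarrow> zpow u (-1) = inv u"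
  using group.int_pow_neg[OF units_group, of u 1] zpow_1[of u] by (simp add: zpow_def units_of_carrier units_of_inv)

lemma zpow_minus_cancel:
  "u \<in> Units A \<Longrightarrow> x \<in> carrier A \<Longrightarrow> zpow u (- a) \<otimes> (zpow u a \<otimes> x) = x"
  using zpow_add[of u "-a" a, symmetric] by (simp add: m_assoc[symmetric])

text \<open>Eigenvalues of a derivation add up in products, and \<open>0 = ad x (u u\<^sup>-\<^sup>1)\<close> shows that \<open>u\<^sup>-\<^sup>1\<close> has the
eigenvalue \<open>- c\<close>. With \<open>c = 0\<close> this covers commuting elements.\<close>

lemma ad_zpow:
  assumes x: "x \<in> carrier A" and u: "u \<in> Units A" and e: "ad x u = c \<odot> u"
  shows "ad x (zpow u a) = (of_int a * c) \<odot> zpow u a"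
proof -
  have uc: "u \<in> carrier A" "inv u \<in> carrier A" using u by auto
  have inv: "ad x (inv u) = (- c) \<odot> inv u"
    using x u uc e by (simp add: ad_inv smult_mult_left smult_mult_right)
  show ?thesis
  proof (induction a rule: int_induct[where k = 0])
    case (step1 i)
    then show ?case using x u uc e
      by (simp add: zpow_add ad_mult smult_mult_left smult_mult_right scale_add_left[symmetric] distrib_right)
  next
    case (step2 i)
    have "zpow u (i - 1) = zpow u i \<otimes> inv u" using zpow_add[OF u, of i "-1"] u by simp
    then show ?case using x u uc inv step2
      by (simp add: ad_mult smult_mult_left smult_mult_right scale_add_left[symmetric] left_diff_distrib)
  qed (use x in simp)
qed

lemma ad_zpow_eq_zero:
  "x \<in> carrier A \<Longrightarrow> u \<in> Units A \<Longrightarrow> ad x u = \<zero> \<Longrightarrow> ad x (zpow u a) = \<zero>"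
  using ad_zpow[of x u 0 a] by auto

text \<open>Subtracting \<open>f b\<close> times a relation from its image under \<open>ad x\<close> removes the term with index \<open>b\<close> and
multiplies any other term by \<open>f i - f b\<close>; for \<open>ad y\<close> the factor is \<open>g i - g b\<close>. One of the two factors
is nonzero, so induction on the number of terms applies.\<close>

lemma simultaneous_eigenvectors_independent:
  assumes "finite S" "x \<in> carrier A" "y \<in> carrier A"
    and "\<And>i. i \<in> S \<Longrightarrow> v i \<in> carrier A"
    and "\<And>i. i \<in> S \<Longrightarrow> ad x (v i) = f i \<odot> v i"
    and "\<And>i. i \<in> S \<Longrightarrow> ad y (v i) = g i \<odot> v i"
    and "inj_on (\<lambda>i. (f i, g i)) S"
    and "(\<Oplus>i\<in>S. v i) = \<zero>"
    and "i \<in> S"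
  shows "v i = \<zero>"
  using assms
proof (induction S arbitrary: v i)
  case (insert b S)
  have vS: "v \<in> S \<rightarrow> carrier A" and vb: "v b \<in> carrier A" using insert.prems by auto
  have sum: "v b \<oplus> (\<Oplus>i\<in>S. v i) = \<zero>"
    using insert.prems(7) insert.hyps vS vb by simp
  have key: "(f' i - f' b) \<odot> v i = \<zero>"
    if z: "z \<in> carrier A" and ez: "\<And>i. i \<in> insert b S \<Longrightarrow> ad z (v i) = f' i \<odot> v i"
      and i: "i \<in> S" for z f' i
  proof -
    have c: "(\<Oplus>i\<in>S. v i) \<in> carrier A" "(\<Oplus>i\<in>S. f' i \<odot> v i) \<in> carrier A"
      "f' b \<odot> (\<Oplus>i\<in>S. v i) \<in> carrier A" "f' b \<odot> v b \<in> carrier A"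
      using vS vb by (auto intro!: finsum_closed)
    have "ad z (v b \<oplus> (\<Oplus>i\<in>S. v i)) = f' b \<odot> v b \<oplus> (\<Oplus>i\<in>S. ad z (v i))"
      using z vb vS ez[of b] c by (simp add: ad_finsum[OF insert.hyps(1)] Pi_iff)
    also have "(\<Oplus>i\<in>S. ad z (v i)) = (\<Oplus>i\<in>S. f' i \<odot> v i)"
      by (rule finsum_cong') (use ez vS in auto)
    finally have 1: "f' b \<odot> v b \<oplus> (\<Oplus>i\<in>S. f' i \<odot> v i) = \<zero>" using sum z by simp
    have 2: "f' b \<odot> v b \<oplus> f' b \<odot> (\<Oplus>i\<in>S. v i) = \<zero>"
      using scale_add_right[OF vb c(1), of "f' b"] sum by simp
    have 3: "(\<Oplus>i\<in>S. f' i \<odot> v i) = f' b \<odot> (\<Oplus>i\<in>S. v i)"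
      using 1 2 c by (metis a_comm minus_equality minus_minus)
    have "(\<Oplus>i\<in>S. (f' i - f' b) \<odot> v i) = (\<Oplus>i\<in>S. f' i \<odot> v i \<oplus> (- f' b) \<odot> v i)"
      by (rule finsum_cong') (use vS in \<open>auto simp: scale_add_left[symmetric] Pi_iff\<close>)
    also have "\<dots> = (\<Oplus>i\<in>S. f' i \<odot> v i) \<oplus> (\<Oplus>i\<in>S. (- f' b) \<odot> v i)"
      by (rule finsum_addf) (use vS in auto)
    also have "(\<Oplus>i\<in>S. (- f' b) \<odot> v i) = (- f' b) \<odot> (\<Oplus>i\<in>S. v i)"
      by (rule scale_finsum[symmetric]) (use insert.hyps(1) vS in auto)
    also have "(\<Oplus>i\<in>S. f' i \<odot> v i) \<oplus> (- f' b) \<odot> (\<Oplus>i\<in>S. v i) = \<zero>"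
      using c(1) by (simp add: 3 scale_add_left[symmetric])
    finally have s: "(\<Oplus>i\<in>S. (f' i - f' b) \<odot> v i) = \<zero>" .
    show ?thesis
    proof (rule insert.IH[of "\<lambda>i. (f' i - f' b) \<odot> v i"])
      show "inj_on (\<lambda>i. (f i, g i)) S" using insert.prems(6) by (auto simp: inj_on_def)
    qed (use insert.prems s i in \<open>auto simp: mult.commute\<close>)
  qed
  have S0: "v j = \<zero>" if j: "j \<in> S" for j
  proof -
    have "j \<noteq> b" using j insert.hyps by auto
    then have "f j \<noteq> f b \<or> g j \<noteq> g b"
      using insert.prems(6) j by (auto simp: inj_on_def)
    then show ?thesis
      using key[of x f j] key[of y g j] insert.prems j scale_eq_zeroD[of _ "v j"]
      by (metis insertCI right_minus_eq)
  qed
  then have "(\<Oplus>i\<in>S. v i) = (\<Oplus>i\<in>S. \<zero>)" by (intro finsum_cong') auto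
  then have "v b = \<zero>" using sum vb by simp
  then show ?case using S0 insert.prems by auto
qed simp

text \<open>The image of a relation under a derivation that lowers indices: the term with index \<open>up j\<close>
contributes to index \<open>j\<close>, and the terms that cannot be lowered are killed.\<close>

lemma finsum_shift_eq_zero:
  fixes up :: "'i \<Rightarrow> 'i"
  assumes S: "finite S" and x: "x \<in> carrier A" and v: "\<And>i. i \<in> S \<Longrightarrow> v i \<in> carrier A"
    and kill: "\<And>i. i \<in> S \<Longrightarrow> i \<notin> range up \<Longrightarrow> ad x (v i) = \<zero>"
    and up: "inj up" and sum: "(\<Oplus>i\<in>S. v i) = \<zero>"
  shows "(\<Oplus>j\<in>up -` S. ad x (v (up j))) = \<zero>"
proof -
  have "(\<Oplus>j\<in>up -` S. ad x (v (up j))) = (\<Oplus>i\<in>up ` (up -` S). ad x (v i))"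
    by (subst finsum_reindex) (use v x inj_on_subset[OF up subset_UNIV] in auto)
  also have "\<dots> = (\<Oplus>i\<in>S. ad x (v i))"
    by (rule add.finprod_mono_neutral_cong_left) (use S v x kill in auto)
  also have "\<dots> = ad x (\<Oplus>i\<in>S. v i)" using ad_finsum[OF S x] v by simp
  finally show ?thesis using sum x by simp
qed

lemma ad_funpow_closed: "x \<in> carrier A \<Longrightarrow> y \<in> carrier A \<Longrightarrow> (ad x ^^ n) y \<in> carrier A"
  by (induction n) auto

lemma ad_funpow_scale: "x \<in> carrier A \<Longrightarrow> y \<in> carrier A \<Longrightarrow> (ad x ^^ n) (c \<odot> y) = c \<odot> (ad x ^^ n) y"
  by (induction n) (auto simp: ad_funpow_closed)

lemma ad_funpow_diff:
  "x \<in> carrier A \<Longrightarrow> y \<in> carrier A \<Longrightarrow> z \<in> carrier A \<Longrightarrow>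
    (ad x ^^ n) (y \<ominus> z) = (ad x ^^ n) y \<ominus> (ad x ^^ n) z"
  by (induction n) (auto simp: ad_funpow_closed)

lemma ad_funpow_commute:
  assumes "x \<in> carrier A" "y \<in> carrier A" "z \<in> carrier A" "ad x y = \<zero>"
  shows "(ad x ^^ n) (ad y z) = ad y ((ad x ^^ n) z)"
  by (induction n) (use assms in \<open>simp_all add: ad_commute[of x y] ad_funpow_closed\<close>)

lemma ad_funpow_mult:
  assumes "x \<in> carrier A" "y \<in> carrier A" "z \<in> carrier A" "ad x y = \<zero>"
  shows "(ad x ^^ n) (y \<otimes> z) = y \<otimes> (ad x ^^ n) z"
  by (induction n) (use assms in \<open>simp_all add: ad_mult ad_funpow_closed\<close>)

lemma ad_funpow_pow_mult:
  assumes "x \<in> carrier A" "t \<in> carrier A" "z \<in> carrier A" "ad x t = \<one>" "ad x z = \<zero>"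
  shows "(ad x ^^ n) (t [^] n \<otimes> z) = of_nat (fact n) \<odot> z"
proof (induction n)
  case (Suc n)
  have "(ad x ^^ Suc n) (t [^] Suc n \<otimes> z) = (ad x ^^ n) (ad x (t [^] Suc n \<otimes> z))"
    by (simp only: funpow_Suc_right o_apply)
  also have "ad x (t [^] Suc n \<otimes> z) = of_nat (Suc n) \<odot> (t [^] n \<otimes> z)"
    using assms ad_nat_pow[of x t "Suc n"]
    by (simp del: nat_pow_Suc of_nat_Suc add: ad_mult smult_mult_left)
  finally show ?case using assms Suc
    by (simp del: funpow.simps nat_pow_Suc add: ad_funpow_scale algebra_simps)
qed (use assms in simp)

text \<open>Think of \<open>V m\<close> as the space of weight \<open>m\<close>. If \<open>n + 1\<close> applications of \<open>ad x\<close> kill \<open>y\<close>, then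
\<open>z = (ad x)\<^sup>n y\<close> commutes with \<open>x\<close> and thus belongs to \<open>K\<close>, as does \<open>w = t\<^sup>n z / n!\<close>. Since
\<open>(ad x)\<^sup>n w = z\<close>, the element \<open>y - w\<close> is killed by \<open>n\<close> applications; it has the same weight as \<open>y\<close>,
because \<open>t\<close> raises weights by as much as \<open>ad x\<close> lowers them.\<close>

lemma taylor:
  fixes V :: "int \<Rightarrow> 'a set"
  assumes x: "x \<in> carrier A" and t: "t \<in> carrier A" and xt: "ad x t = \<one>"
    and V: "\<And>m y. y \<in> V m \<Longrightarrow> y \<in> carrier A"
    and V_scale: "\<And>m y c. y \<in> V m \<Longrightarrow> c \<odot> y \<in> V m"
    and V_diff: "\<And>m y z. y \<in> V m \<Longrightarrow> z \<in> V m \<Longrightarrow> y \<ominus> z \<in> V m"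
    and V_lower: "\<And>m y. y \<in> V m \<Longrightarrow> ad x y \<in> V (m - 1)"
    and V_raise: "\<And>m y. y \<in> V m \<Longrightarrow> t \<otimes> y \<in> V (m + 1)"
    and K: "is_subalg K A" and tK: "t \<in> K"
    and base: "\<And>m y. y \<in> V m \<Longrightarrow> ad x y = \<zero> \<Longrightarrow> y \<in> K"
    and y: "y \<in> V m" and nil: "(ad x ^^ n) y = \<zero>"
  shows "y \<in> K"
  using y nil
proof (induction n arbitrary: y m)
  case 0
  then show ?case using is_subalgD(3)[OF K] by simp
next
  case (Suc n)
  note KD = is_subalgD[OF K]
  define z where "z = (ad x ^^ n) y"
  have lower: "(ad x ^^ k) y \<in> V (m - int k)" for k
    using Suc.prems(1) V_lower by (induction k) (force simp: algebra_simps)+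
  have raise: "w \<in> V i \<Longrightarrow> t [^] k \<otimes> w \<in> V (i + int k)" for w k i
  proof (induction k arbitrary: i w)
    case (Suc k)
    have "t [^] k \<otimes> (t \<otimes> w) \<in> V ((i + 1) + int k)"
      using V_raise[OF Suc.prems] by (rule Suc.IH)
    then show ?case using V[OF Suc.prems] t by (simp add: m_assoc algebra_simps)
  qed (use V in auto)
  have zV: "z \<in> V (m - int n)" unfolding z_def by (rule lower)
  then have zc: "z \<in> carrier A" by (rule V)
  have xz: "ad x z = \<zero>" using Suc.prems(2) by (simp add: z_def)
  then have zK: "z \<in> K" using zV base by blast
  have tnK: "t [^] k \<in> K" for k :: nat by (induction k) (simp_all add: KD(2,5) tK)
  define w where "w = inverse (of_nat (fact n)) \<odot> (t [^] n \<otimes> z)"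
  have wK: "w \<in> K" unfolding w_def by (intro KD(5,6) tnK zK)
  have wV: "w \<in> V m" unfolding w_def using raise[OF zV, of n] V_scale by simp
  have yc: "y \<in> carrier A" using Suc.prems V by blast
  have wc: "w \<in> carrier A" using wV V by blast
  have "(ad x ^^ n) w = z"
    unfolding w_def using x t zc xt xz
    by (simp add: ad_funpow_scale ad_funpow_pow_mult)
  then have "(ad x ^^ n) (y \<ominus> w) = \<zero>"
    using x yc wc zc by (simp add: ad_funpow_diff z_def[symmetric])
  then have "y \<ominus> w \<in> K" using Suc.IH V_diff[OF Suc.prems(1) wV] by blast
  moreover have "y = (y \<ominus> w) \<oplus> w" using yc wc by algebra
  ultimately show ?case using wK KD(4) by metis
qed

end

section \<open>Localized Weyl algebras\<close>

text \<open>The model is \<open>P = \<partial>\<close>, \<open>d = t \<partial>\<close>, with \<open>\<partial>\<close> invertible; the coordinate \<open>t\<close> is recovered from \<open>d\<close>.\<close>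

locale weyl_pair = complex_alg +
  fixes P d
  assumes P_unit: "P \<in> Units A" and d_closed [simp]: "d \<in> carrier A" and ad_P_d [simp]: "ad P d = P"
begin

lemma P_closed [simp]: "P \<in> carrier A" "inv P \<in> carrier A"
  using P_unit by auto

lemma P_inv [simp]: "P \<otimes> inv P = \<one>" "inv P \<otimes> P = \<one>"
  using P_unit by auto

definition t :: 'a where "t = d \<otimes> inv P"

lemma t_closed [simp]: "t \<in> carrier A"
  by (simp add: t_def)

lemma d_eq: "d = t \<otimes> P"
  by (simp add: t_def m_assoc)

lemma ad_d_P: "ad d P = (-1) \<odot> P"
  using ad_antisym[of P d] by (simp add: minus_eq_scale)

lemma ad_d_zpow: "ad d (zpow P a) = (- of_int a) \<odot> zpow P a"
  using ad_zpow[of d P "-1" a] by (simp add: ad_d_P P_unit)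

lemma ad_d_ad_P:
  assumes "y \<in> carrier A" "ad d y = c \<odot> y"
  shows "ad d (ad P y) = (c - 1) \<odot> ad P y"
proof -
  have "ad d (ad P y) = ad ((-1) \<odot> P) y \<oplus> c \<odot> ad P y"
    using assms by (simp add: ad_jacobi[of d P y] ad_d_P)
  then show ?thesis
    using assms(1) by (simp add: ad_scale_left scale_add_left[symmetric])
qed

lemma ad_P_inv: "ad P (inv P) = \<zero>"
  using ad_inv[of P P] by (simp add: P_unit)

lemma ad_P_zpow [simp]: "ad P (zpow P a) = \<zero>"
  by (rule ad_zpow_eq_zero) (auto simp: P_unit)

lemma ad_P_t [simp]: "ad P t = \<one>"
  by (simp add: t_def ad_mult ad_P_inv)

lemma ad_d_t: "ad d t = t"
  using ad_d_zpow[of "-1"] by (simp add: t_def ad_mult P_unit)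

lemma ad_P_t_pow: "ad P (t [^] (k::nat)) = of_nat k \<odot> t [^] (k - 1)"
  by (rule ad_nat_pow) auto

lemma ad_d_t_mult:
  assumes "y \<in> carrier A" "ad d y = c \<odot> y"
  shows "ad d (t \<otimes> y) = (c + 1) \<odot> (t \<otimes> y)"
  using assms by (simp add: ad_mult ad_d_t smult_mult_right scale_add_left a_comm)

lemma t_zpow: "t \<otimes> zpow P a = zpow P a \<otimes> t \<oplus> (- of_int a) \<odot> zpow P (a - 1)"
proof -
  have [simp]: "zpow P a \<in> carrier A" using P_unit by simp
  have 1: "zpow P (a - 1) = zpow P a \<otimes> inv P" using zpow_add[OF P_unit, of a "-1"] P_unit by simp
  have 2: "inv P \<otimes> zpow P a = zpow P a \<otimes> inv P"
    using zpow_add[OF P_unit, of "-1" a] zpow_add[OF P_unit, of a "-1"] P_unit by (simp add: add.commute)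
  have 3: "d \<otimes> zpow P a = zpow P a \<otimes> d \<oplus> ad d (zpow P a)"
    by (rule mult_swap_ad) auto
  show ?thesis
    by (simp add: t_def m_assoc 2 1)
      (simp add: m_assoc[symmetric] 3 l_distr ad_d_zpow smult_mult_left)
qed

lemma ad_eq_zero_zpow:
  "x \<in> carrier A \<Longrightarrow> ad x P = \<zero> \<Longrightarrow> ad x (zpow P a) = \<zero>"
  using ad_zpow_eq_zero P_unit by blast

lemma ad_eq_zero_t:
  assumes "x \<in> carrier A" "ad x P = \<zero>" "ad x d = \<zero>"
  shows "ad x t = \<zero>"
  using ad_eq_zero_zpow[of x "-1"] assms P_unit by (simp add: t_def ad_mult)

end

locale weyl_pairs = W1: weyl_pair A P1 d1 + W2: weyl_pair A P2 d2
  for A (structure) and P1 d1 P2 d2 +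
  assumes ad_P1_P2 [simp]: "W1.ad P1 P2 = \<zero>" and ad_P1_d2 [simp]: "W1.ad P1 d2 = \<zero>"
    and ad_P2_d1 [simp]: "W1.ad P2 d1 = \<zero>" and ad_d1_d2 [simp]: "W1.ad d1 d2 = \<zero>"
begin

lemma ad_sym [simp]:
  "W1.ad P2 P1 = \<zero>" "W1.ad d2 P1 = \<zero>" "W1.ad d1 P2 = \<zero>" "W1.ad d2 d1 = \<zero>"
  by (rule W1.ad_zero_sym; simp)+

text \<open>\<open>s1\<close> and \<open>s2\<close> are the coordinates \<open>t\<^sub>1\<close> and \<open>t\<^sub>2\<close> as elements of the algebra; \<open>t1\<close> and \<open>t2\<close> denote
polynomials.\<close>

abbreviation "s1 \<equiv> W1.t"
abbreviation "s2 \<equiv> W2.t"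

lemma ad_t [simp]:
  "W1.ad P2 s1 = \<zero>" "W1.ad P1 s2 = \<zero>" "W1.ad d2 s1 = \<zero>" "W1.ad d1 s2 = \<zero>"
  by (rule W1.ad_eq_zero_t W2.ad_eq_zero_t; simp)+

lemma ad_t_sym [simp]:
  "W1.ad s1 P2 = \<zero>" "W1.ad s2 P1 = \<zero>" "W1.ad s1 d2 = \<zero>" "W1.ad s2 d1 = \<zero>"
  by (rule W1.ad_zero_sym; simp)+

lemma ad_t2_t1: "W1.ad s2 s1 = \<zero>"
  by (rule W1.ad_eq_zero_t) simp_all

definition monomial :: "int \<times> int \<times> nat \<times> nat \<Rightarrow> 'a"
  where "monomial = (\<lambda>(a, b, k, l). W1.zpow P1 a \<otimes> (W1.zpow P2 b \<otimes> (s1 [^] k \<otimes> s2 [^] l)))"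

text \<open>\<open>H\<close> and \<open>B\<close> are written exactly as in the definitions for a localization of the enveloping algebra,
with the images of \<open>\<partial>\<^sub>i\<close> and \<open>d\<^sub>i\<close> as parameters.\<close>

definition H :: "'a set"
  where "H = {u \<in> carrier A. \<forall>v\<in>{P1, P2, d1, d2}. W1.ad u v = \<zero>}"

definition B :: "'a set"
  where "B = generated_subalg A {P1, P2, d1, d2, inv P1, inv P2}"

lemmas units [simp] = W1.P_unit W2.P_unit

lemma monomial_closed [simp]: "monomial i \<in> carrier A"
  by (cases i) (auto simp: monomial_def)

lemma H_closed: "u \<in> H \<Longrightarrow> u \<in> carrier A"
  by (simp add: H_def)

lemma H_ad:
  assumes "u \<in> H"
  shows "W1.ad P1 u = \<zero>" "W1.ad P2 u = \<zero>" "W1.ad d1 u = \<zero>" "W1.ad d2 u = \<zero>"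
  using assms by (auto simp: H_def intro: W1.ad_zero_sym[of u])

lemma H_memI:
  assumes "u \<in> carrier A" "W1.ad P1 u = \<zero>" "W1.ad P2 u = \<zero>" "W1.ad d1 u = \<zero>" "W1.ad d2 u = \<zero>"
  shows "u \<in> H"
  using assms by (auto simp: H_def intro: W1.ad_zero_sym[of _ u])

lemma is_subalg_H: "is_subalg H A"
proof -
  have "H = {y \<in> carrier A. \<forall>x\<in>{P1, P2, d1, d2}. y \<otimes> x = x \<otimes> y}"
    by (auto simp: H_def W1.ad_eq_zero_iff)
  then show ?thesis using W1.is_subalg_centralizer[of "{P1, P2, d1, d2}"] by simp
qed

lemma is_subalg_B: "is_subalg B A"
  unfolding B_def by (rule W1.is_subalg_generated) auto

lemma B_gens: "P1 \<in> B" "P2 \<in> B" "d1 \<in> B" "d2 \<in> B" "inv P1 \<in> B" "inv P2 \<in> B"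
  using W1.generated_subalg_superset[of "{P1, P2, d1, d2, inv P1, inv P2}"] unfolding B_def by simp_all

lemma B_closed: "b \<in> B \<Longrightarrow> b \<in> carrier A"
  using W1.is_subalgD(1)[OF is_subalg_B] by blast

lemma B_H_commute:
  assumes "b \<in> B" "u \<in> H"
  shows "b \<otimes> u = u \<otimes> b"
proof -
  have uc: "u \<in> carrier A" using assms(2) by (rule H_closed)
  have "is_subalg {y \<in> carrier A. \<forall>x\<in>{u}. y \<otimes> x = x \<otimes> y} A"
    by (rule W1.is_subalg_centralizer) (use uc in auto)
  moreover have "{P1, P2, d1, d2, inv P1, inv P2} \<subseteq> {y \<in> carrier A. \<forall>x\<in>{u}. y \<otimes> x = x \<otimes> y}"
  proof -
    have "W1.ad u (inv P1) = \<zero>" "W1.ad u (inv P2) = \<zero>"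
      using assms(2) uc W1.ad_inv[of u P1] W1.ad_inv[of u P2] by (auto simp: H_def)
    then show ?thesis using assms(2) uc by (auto simp: H_def W1.ad_eq_zero_iff)
  qed
  ultimately have "B \<subseteq> {y \<in> carrier A. \<forall>x\<in>{u}. y \<otimes> x = x \<otimes> y}"
    unfolding B_def by (rule W1.generated_subalg_least)
  then have "b \<in> {y \<in> carrier A. \<forall>x\<in>{u}. y \<otimes> x = x \<otimes> y}" using assms(1) by (rule subsetD)
  then show ?thesis by simp
qed

lemma zpow_memI:
  assumes "is_subalg K A" "u \<in> Units A" "u \<in> K" "inv u \<in> K"
  shows "W1.zpow u a \<in> K"
proof (induction a rule: int_induct[where k = 0])
  case (step1 i)
  then show ?case using assms W1.is_subalgD(5)[OF assms(1)] by (simp add: W1.zpow_add)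
next
  case (step2 i)
  then show ?case using assms W1.is_subalgD(5)[OF assms(1)] W1.zpow_add[of u i "-1"] by simp
qed (use assms W1.is_subalgD(2) in simp)

lemma pow_memI: "is_subalg K A \<Longrightarrow> x \<in> K \<Longrightarrow> x [^] (k::nat) \<in> K"
  by (induction k) (auto dest: W1.is_subalgD(2,5))

lemma t_B: "s1 \<in> B" "s2 \<in> B"
  unfolding W1.t_def W2.t_def using B_gens W1.is_subalgD(5)[OF is_subalg_B] by auto

lemma monomial_B: "monomial i \<in> B"
proof (cases i)
  case (fields a b k l)
  then show ?thesis
    using zpow_memI[OF is_subalg_B] pow_memI[OF is_subalg_B] B_gens t_B W1.is_subalgD(5)[OF is_subalg_B]
    by (simp add: monomial_def)
qed

text \<open>With the powers of \<open>P\<^sub>i\<close> to the left of those of \<open>t\<^sub>i\<close>, left multiplication by \<open>P\<^sub>i\<close>, its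
inverse or \<open>t\<^sub>i\<close> produces at most two monomials.\<close>

lemma gen_mult_monomial:
  "P1 \<otimes> monomial (a, b, k, l) = monomial (a + 1, b, k, l)"
  "inv P1 \<otimes> monomial (a, b, k, l) = monomial (a - 1, b, k, l)"
  "P2 \<otimes> monomial (a, b, k, l) = monomial (a, b + 1, k, l)"
  "inv P2 \<otimes> monomial (a, b, k, l) = monomial (a, b - 1, k, l)"
  "s1 \<otimes> monomial (a, b, k, l) = monomial (a, b, Suc k, l) \<oplus> (- of_int a) \<odot> monomial (a - 1, b, k, l)"
  "s2 \<otimes> monomial (a, b, k, l) = monomial (a, b, k, Suc l) \<oplus> (- of_int b) \<odot> monomial (a, b - 1, k, l)"
proof -
  have z1: "W1.zpow P1 (a + 1) = P1 \<otimes> W1.zpow P1 a" "W1.zpow P1 (a - 1) = inv P1 \<otimes> W1.zpow P1 a"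
    using W1.zpow_add[of P1 1 a] W1.zpow_add[of P1 "-1" a] by (simp_all add: add.commute)
  have z2: "W1.zpow P2 (b + 1) = P2 \<otimes> W1.zpow P2 b" "W1.zpow P2 (b - 1) = inv P2 \<otimes> W1.zpow P2 b"
    using W1.zpow_add[of P2 1 b] W1.zpow_add[of P2 "-1" b] by (simp_all add: add.commute)
  have P2P1: "W1.ad P2 (W1.zpow P1 a) = \<zero>"
    by (rule W1.ad_eq_zero_zpow) simp_all
  have P2'P1: "W1.ad (inv P2) (W1.zpow P1 a) = \<zero>"
    using W1.ad_inv[of "W1.zpow P1 a" P2] W1.ad_zero_sym[OF _ _ P2P1] W1.ad_zero_sym[of "W1.zpow P1 a" "inv P2"]
    by auto
  have t1P2: "W1.ad s1 (W1.zpow P2 b) = \<zero>"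
    by (rule W2.ad_eq_zero_zpow) simp_all
  have t2P1: "W1.ad s2 (W1.zpow P1 a) = \<zero>"
    by (rule W1.ad_eq_zero_zpow) simp_all
  have t2t1: "W1.ad s2 (s1 [^] k) = \<zero>"
    by (rule W1.ad_nat_pow_eq_zero) (auto simp: ad_t2_t1)
  have powS: "x \<otimes> x [^] n = x [^] Suc n" if "x \<in> carrier A" for x and n :: nat
    using that W1.nat_pow_Suc2 by simp
  show "P1 \<otimes> monomial (a, b, k, l) = monomial (a + 1, b, k, l)"
    "inv P1 \<otimes> monomial (a, b, k, l) = monomial (a - 1, b, k, l)"
    by (simp_all add: monomial_def z1 W1.m_assoc)
  show "P2 \<otimes> monomial (a, b, k, l) = monomial (a, b + 1, k, l)"
    "inv P2 \<otimes> monomial (a, b, k, l) = monomial (a, b - 1, k, l)"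
    by (simp_all add: monomial_def z2 W1.m_assoc W1.ad_zero_lcomm[OF P2P1] W1.ad_zero_lcomm[OF P2'P1])
  have "s1 \<otimes> monomial (a, b, k, l) = (s1 \<otimes> W1.zpow P1 a) \<otimes> (W1.zpow P2 b \<otimes> (s1 [^] k \<otimes> s2 [^] l))"
    by (simp add: monomial_def W1.m_assoc)
  also have "\<dots> = W1.zpow P1 a \<otimes> (s1 \<otimes> (W1.zpow P2 b \<otimes> (s1 [^] k \<otimes> s2 [^] l)))
      \<oplus> (- of_int a) \<odot> monomial (a - 1, b, k, l)"
    by (simp add: W1.t_zpow W1.l_distr W1.m_assoc monomial_def W1.smult_mult_left)
  also have "s1 \<otimes> (W1.zpow P2 b \<otimes> (s1 [^] k \<otimes> s2 [^] l)) = W1.zpow P2 b \<otimes> (s1 [^] Suc k \<otimes> s2 [^] l)"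
    by (subst powS[symmetric]) (simp_all add: W1.ad_zero_lcomm[OF t1P2] W1.m_assoc)
  finally show "s1 \<otimes> monomial (a, b, k, l) = monomial (a, b, Suc k, l) \<oplus> (- of_int a) \<odot> monomial (a - 1, b, k, l)"
    by (simp add: monomial_def)
  have "s2 \<otimes> monomial (a, b, k, l) = W1.zpow P1 a \<otimes> ((s2 \<otimes> W1.zpow P2 b) \<otimes> (s1 [^] k \<otimes> s2 [^] l))"
    by (simp add: monomial_def W1.m_assoc W1.ad_zero_lcomm[OF t2P1])
  also have "\<dots> = W1.zpow P1 a \<otimes> (W1.zpow P2 b \<otimes> (s2 \<otimes> (s1 [^] k \<otimes> s2 [^] l)))
      \<oplus> (- of_int b) \<odot> monomial (a, b - 1, k, l)"
    by (simp add: W2.t_zpow W1.l_distr W1.r_distr W1.m_assoc monomial_def W1.smult_mult_left W1.smult_mult_right)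
  also have "s2 \<otimes> (s1 [^] k \<otimes> s2 [^] l) = s1 [^] k \<otimes> s2 [^] Suc l"
    by (subst powS[symmetric]) (simp_all add: W1.ad_zero_lcomm[OF t2t1])
  finally show "s2 \<otimes> monomial (a, b, k, l) = monomial (a, b, k, Suc l) \<oplus> (- of_int b) \<odot> monomial (a, b - 1, k, l)"
    by (simp add: monomial_def)
qed

text \<open>The elements that preserve the span \<open>M\<close> of the monomials under left multiplication form a subalgebra
containing the generators of \<open>B\<close>. Hence \<open>b = b 1 \<in> M\<close> for all \<open>b \<in> B\<close>.\<close>

lemma B_subset_span_monomial: "B \<subseteq> linear_span A (range monomial)"
proof -
  let ?M = "linear_span A (range monomial)"
  have sm: "submodule ?M complex_ring A" by (rule W1.submodule_linear_span) auto
  note MD = W1.is_submoduleD[OF sm]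
  have mM: "monomial i \<in> ?M" for i using W1.linear_span_superset[of "range monomial"] by (rule subsetD) simp
  let ?L = "{y \<in> carrier A. \<forall>x\<in>?M. y \<otimes> x \<in> ?M}"
  have L: "g \<in> ?L" if g: "g \<in> carrier A" and gm: "\<And>a b k l. g \<otimes> monomial (a, b, k, l) \<in> ?M" for g
  proof -
    have "g \<otimes> x \<in> ?M" if "x \<in> ?M" for x
      by (rule W1.linear_map_linear_span[OF _ sm, of "range monomial" "\<lambda>x. g \<otimes> x"])
        (use g gm that in \<open>auto simp: W1.r_distr W1.smult_mult_right\<close>)
    with g show ?thesis by auto
  qed
  have Lalg: "is_subalg ?L A"
    by (rule W1.is_subalgI) (use MD in \<open>auto simp: W1.l_distr W1.smult_mult_left W1.m_assoc subset_iff\<close>)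
  have PL: "P1 \<in> ?L" "P2 \<in> ?L" "inv P1 \<in> ?L" "inv P2 \<in> ?L" and tL: "s1 \<in> ?L" "s2 \<in> ?L"
    by (rule L; simp add: gen_mult_monomial mM MD(3,4))+
  have "s1 \<otimes> P1 \<in> ?L" "s2 \<otimes> P2 \<in> ?L"
    by (rule W1.is_subalgD(5)[OF Lalg]; fact)+
  then have "d1 \<in> ?L" "d2 \<in> ?L"
    by (simp_all only: W1.d_eq[symmetric] W2.d_eq[symmetric])
  with PL have "{P1, P2, d1, d2, inv P1, inv P2} \<subseteq> ?L" by blast
  then have BL: "B \<subseteq> ?L" unfolding B_def using Lalg by (intro W1.generated_subalg_least)
  have one: "\<one> \<in> ?M" using mM[of "(0, 0, 0, 0)"] by (simp add: monomial_def)
  show ?thesis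
  proof
    fix b assume "b \<in> B"
    then have "b \<otimes> \<one> \<in> ?M" using BL one by blast
    then show "b \<in> ?M" using B_closed[OF \<open>b \<in> B\<close>] by simp
  qed
qed

lemma ad_P_monomial:
  assumes u: "u \<in> H"
  shows "W1.ad P1 (monomial (a, b, k, l) \<otimes> u) = monomial (a, b, k - 1, l) \<otimes> (of_nat k \<odot> u)"
    and "W1.ad P2 (monomial (a, b, k, l) \<otimes> u) = monomial (a, b, k, l - 1) \<otimes> (of_nat l \<odot> u)"
proof -
  have [simp]: "u \<in> carrier A" using u by (rule H_closed)
  have [simp]: "W1.ad P1 (W1.zpow P2 b) = \<zero>" "W1.ad P2 (W1.zpow P1 a) = \<zero>"
    "W1.ad P1 (s2 [^] l) = \<zero>" "W1.ad P2 (s1 [^] k) = \<zero>"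
    by (simp_all add: W1.ad_zpow_eq_zero W1.ad_nat_pow_eq_zero)
  show "W1.ad P1 (monomial (a, b, k, l) \<otimes> u) = monomial (a, b, k - 1, l) \<otimes> (of_nat k \<odot> u)"
    by (simp add: monomial_def W1.ad_mult W1.ad_P_t_pow H_ad[OF u] W1.smult_mult_left W1.smult_mult_right)
  show "W1.ad P2 (monomial (a, b, k, l) \<otimes> u) = monomial (a, b, k, l - 1) \<otimes> (of_nat l \<odot> u)"
    by (simp add: monomial_def W1.ad_mult W2.ad_P_t_pow H_ad[OF u] W1.smult_mult_left W1.smult_mult_right)
qed

lemma ad_d_monomial:
  assumes u: "u \<in> H"
  shows "W1.ad d1 (monomial (a, b, 0, 0) \<otimes> u) = (- of_int a) \<odot> (monomial (a, b, 0, 0) \<otimes> u)"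
    and "W1.ad d2 (monomial (a, b, 0, 0) \<otimes> u) = (- of_int b) \<odot> (monomial (a, b, 0, 0) \<otimes> u)"
proof -
  have [simp]: "u \<in> carrier A" using u by (rule H_closed)
  have [simp]: "W1.ad d1 (W1.zpow P2 b) = \<zero>" "W1.ad d2 (W1.zpow P1 a) = \<zero>"
    by (simp_all add: W1.ad_zpow_eq_zero)
  show "W1.ad d1 (monomial (a, b, 0, 0) \<otimes> u) = (- of_int a) \<odot> (monomial (a, b, 0, 0) \<otimes> u)"
    by (simp add: monomial_def W1.ad_mult W1.ad_d_zpow H_ad[OF u] W1.smult_mult_left W1.smult_mult_right)
  show "W1.ad d2 (monomial (a, b, 0, 0) \<otimes> u) = (- of_int b) \<odot> (monomial (a, b, 0, 0) \<otimes> u)"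
    by (simp add: monomial_def W1.ad_mult W2.ad_d_zpow H_ad[OF u] W1.smult_mult_left W1.smult_mult_right)
qed

lemma monomial_const_mult_eq_zero:
  assumes "u \<in> carrier A" "monomial (a, b, 0, 0) \<otimes> u = \<zero>"
  shows "u = \<zero>"
proof -
  have "u = W1.zpow P2 (- b) \<otimes> (W1.zpow P1 (- a) \<otimes> (monomial (a, b, 0, 0) \<otimes> u))"
    using assms(1) by (simp add: monomial_def W1.m_assoc W1.zpow_minus_cancel)
  then show ?thesis by (simp add: assms(2))
qed

text \<open>Induction on a bound \<open>n\<close> for the total degree in \<open>t\<^sub>1, t\<^sub>2\<close>. The derivations \<open>ad P\<^sub>1\<close> and \<open>ad P\<^sub>2\<close> turn
the relation into relations of smaller degree, whose coefficients are nonzero multiples of the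
\<open>h (a, b, k, l)\<close> with \<open>k > 0\<close>, respectively \<open>l > 0\<close>. What remains is a relation of degree zero, whose
terms are eigenvectors for different pairs of eigenvalues of \<open>ad d\<^sub>1\<close> and \<open>ad d\<^sub>2\<close>.\<close>

lemma monomial_independent:
  assumes "finite S" "\<And>i. i \<in> S \<Longrightarrow> h i \<in> H"
    and "\<And>a b k l. (a, b, k, l) \<in> S \<Longrightarrow> k + l \<le> n"
    and "(\<Oplus>i\<in>S. monomial i \<otimes> h i) = \<zero>" "i \<in> S"
  shows "h i = \<zero>"
  using assms
proof (induction n arbitrary: S h i)
  case (0 S h i)
  have hc: "h i \<in> carrier A" if "i \<in> S" for i using 0(2) that H_closed by blast
  have S0: "\<exists>a b. i = (a, b, 0, 0)" if "i \<in> S" for i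
    using 0(3) that by (cases i) fastforce
  have "monomial i \<otimes> h i = \<zero>"
  proof (rule W1.simultaneous_eigenvectors_independent[where x = d1 and y = d2 and S = S
        and v = "\<lambda>i. monomial i \<otimes> h i" and f = "\<lambda>i. - of_int (fst i)" and g = "\<lambda>i. - of_int (fst (snd i))"])
    show "inj_on (\<lambda>i. (- complex_of_int (fst i), - complex_of_int (fst (snd i)))) S"
      by (rule inj_onI) (auto dest!: S0)
    fix j assume j: "j \<in> S"
    then obtain a b where "j = (a, b, 0, 0)" using S0 by blast
    then show "W1.ad d1 (monomial j \<otimes> h j) = - of_int (fst j) \<odot> (monomial j \<otimes> h j)"
      "W1.ad d2 (monomial j \<otimes> h j) = - of_int (fst (snd j)) \<odot> (monomial j \<otimes> h j)"
      using ad_d_monomial[OF 0(2)[OF j]] by auto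
  qed (use 0 hc in auto)
  then show ?case using S0[OF 0(5)] monomial_const_mult_eq_zero[OF hc[OF 0(5)]] by auto
next
  case (Suc n S h i)
  have hc: "h i \<in> carrier A" if "i \<in> S" for i using Suc(3) that H_closed by blast
  define up1 :: "int \<times> int \<times> nat \<times> nat \<Rightarrow> int \<times> int \<times> nat \<times> nat"
    where "up1 = (\<lambda>(a, b, k, l). (a, b, Suc k, l))"
  define up2 :: "int \<times> int \<times> nat \<times> nat \<Rightarrow> int \<times> int \<times> nat \<times> nat"
    where "up2 = (\<lambda>(a, b, k, l). (a, b, k, Suc l))"
  have inj: "inj up1" "inj up2" by (auto simp: inj_def up1_def up2_def)
  have main: "h (up i) = \<zero>"
    if up: "inj up" "x \<in> carrier A" "\<And>j. c j \<noteq> 0"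
      and ad_up: "\<And>j u. u \<in> H \<Longrightarrow> W1.ad x (monomial (up j) \<otimes> u) = monomial j \<otimes> (c j \<odot> u)"
      and ad_0: "\<And>j u. u \<in> H \<Longrightarrow> j \<notin> range up \<Longrightarrow> W1.ad x (monomial j \<otimes> u) = \<zero>"
      and deg: "\<And>a b k l. (a, b, k, l) \<in> up -` S \<Longrightarrow> k + l \<le> n"
      and i: "up i \<in> S" for up x c i
  proof -
    have "(\<Oplus>j\<in>up -` S. W1.ad x (monomial (up j) \<otimes> h (up j))) = \<zero>"
      by (rule W1.finsum_shift_eq_zero[where v = "\<lambda>i. monomial i \<otimes> h i"])
        (use up Suc.prems hc ad_0 in auto)
    moreover have "(\<Oplus>j\<in>up -` S. W1.ad x (monomial (up j) \<otimes> h (up j))) = (\<Oplus>j\<in>up -` S. monomial j \<otimes> (c j \<odot> h (up j)))"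
      by (rule W1.finsum_cong') (use ad_up Suc.prems hc in auto)
    ultimately have "(\<Oplus>j\<in>up -` S. monomial j \<otimes> (c j \<odot> h (up j))) = \<zero>" by simp
    then have "c i \<odot> h (up i) = \<zero>"
      by (intro Suc.IH[of "up -` S" "\<lambda>j. c j \<odot> h (up j)"])
        (use i deg Suc.prems(1,2) finite_vimageI[OF Suc.prems(1) up(1)] W1.is_subalgD(6)[OF is_subalg_H] in auto)
    then show ?thesis using W1.scale_eq_zeroD hc[OF i] up(3) by blast
  qed
  have up1_0: "h (up1 j) = \<zero>" if "up1 j \<in> S" for j
  proof (rule main[of up1 P1 "\<lambda>(a, b, k, l). of_nat (Suc k)"])
    fix j :: "int \<times> int \<times> nat \<times> nat" and u assume u: "u \<in> H"
    obtain a b k l where j: "j = (a :: int, b :: int, k :: nat, l :: nat)" by (cases j)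
    show "W1.ad P1 (monomial (up1 j) \<otimes> u) = monomial j \<otimes> ((case j of (a, b, k, l) \<Rightarrow> of_nat (Suc k)) \<odot> u)"
      using ad_P_monomial(1)[OF u, of a b "Suc k" l] by (simp add: j up1_def del: of_nat_Suc)
    assume "j \<notin> range up1"
    then have "k = 0" by (cases k) (auto simp: up1_def j image_iff)
    then show "W1.ad P1 (monomial j \<otimes> u) = \<zero>"
      using ad_P_monomial(1)[OF u, of a b k l] H_closed[OF u] by (simp add: j)
  next
    fix a b k l assume "(a, b, k, l) \<in> up1 -` S"
    then show "k + l \<le> n" using Suc.prems(3)[of a b "Suc k" l] by (auto simp: up1_def)
  qed (use inj that in \<open>auto split: prod.splits simp del: of_nat_Suc\<close>)
  have up2_0: "h (up2 j) = \<zero>" if "up2 j \<in> S" for j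
  proof (rule main[of up2 P2 "\<lambda>(a, b, k, l). of_nat (Suc l)"])
    fix j :: "int \<times> int \<times> nat \<times> nat" and u assume u: "u \<in> H"
    obtain a b k l where j: "j = (a :: int, b :: int, k :: nat, l :: nat)" by (cases j)
    show "W1.ad P2 (monomial (up2 j) \<otimes> u) = monomial j \<otimes> ((case j of (a, b, k, l) \<Rightarrow> of_nat (Suc l)) \<odot> u)"
      using ad_P_monomial(2)[OF u, of a b k "Suc l"] by (simp add: j up2_def del: of_nat_Suc)
    assume "j \<notin> range up2"
    then have "l = 0" by (cases l) (auto simp: up2_def j image_iff)
    then show "W1.ad P2 (monomial j \<otimes> u) = \<zero>"
      using ad_P_monomial(2)[OF u, of a b k l] H_closed[OF u] by (simp add: j)
  next
    fix a b k l assume "(a, b, k, l) \<in> up2 -` S"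
    then show "k + l \<le> n" using Suc.prems(3)[of a b k "Suc l"] by (auto simp: up2_def)
  qed (use inj that in \<open>auto split: prod.splits simp del: of_nat_Suc\<close>)
  have pos: "h (a, b, k, l) = \<zero>" if "(a, b, k, l) \<in> S" "k > 0 \<or> l > 0" for a b k l
    using that up1_0[of "(a, b, k - 1, l)"] up2_0[of "(a, b, k, l - 1)"]
    by (auto simp: up1_def up2_def)
  let ?S0 = "{i \<in> S. \<exists>a b. i = (a, b, 0, 0)}"
  have "(\<Oplus>i\<in>?S0. monomial i \<otimes> h i) = (\<Oplus>i\<in>S. monomial i \<otimes> h i)"
    by (rule W1.add.finprod_mono_neutral_cong_left) (use Suc.prems(1) hc pos in force)+
  then have "(\<Oplus>i\<in>?S0. monomial i \<otimes> h i) = \<zero>" using Suc.prems by simp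
  then have "h i = \<zero>" if "i \<in> ?S0"
    by (intro Suc.IH[of ?S0 h]) (use Suc.prems(1,2) that in auto)
  with pos Suc.prems(5) show ?case by (cases i) fastforce
qed

context
  fixes K :: "'a set"
  assumes K: "is_subalg K A" and BK: "B \<subseteq> K" and HK: "H \<subseteq> K"
begin

text \<open>\<open>P\<^sub>i\<close> has weight \<open>-1\<close> for \<open>ad d\<^sub>i\<close>, so multiplication by powers of the \<open>P\<^sub>i\<close> moves \<open>x\<close> to weight zero, that
is, into \<open>H\<close>.\<close>

lemma weight_vector_killed_by_P_mem:
  assumes x: "x \<in> carrier A" and P: "W1.ad P1 x = \<zero>" "W1.ad P2 x = \<zero>"
    and w: "W1.ad d1 x = of_int m1 \<odot> x" "W1.ad d2 x = of_int m2 \<odot> x"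
  shows "x \<in> K"
proof -
  let ?y = "W1.zpow P2 m2 \<otimes> (W1.zpow P1 m1 \<otimes> x)"
  have comm: "W1.ad P1 (W1.zpow P2 m2) = \<zero>" "W1.ad P2 (W1.zpow P1 m1) = \<zero>"
    "W1.ad d1 (W1.zpow P2 m2) = \<zero>" "W1.ad d2 (W1.zpow P1 m1) = \<zero>"
    by (simp_all add: W1.ad_zpow_eq_zero)
  have "?y \<in> H"
    by (rule H_memI)
      (use x in \<open>simp_all add: W1.ad_mult comm P w W1.ad_d_zpow W2.ad_d_zpow W1.smult_mult_left
          W1.smult_mult_right W1.scale_add_left[symmetric]\<close>)
  moreover have "x = W1.zpow P1 (- m1) \<otimes> (W1.zpow P2 (- m2) \<otimes> ?y)"
    using x by (simp add: W1.zpow_minus_cancel)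
  moreover have "W1.zpow P1 (- m1) \<in> K" "W1.zpow P2 (- m2) \<in> K"
    by (rule zpow_memI[OF K]; simp add: subsetD[OF BK] B_gens)+
  ultimately show ?thesis using HK W1.is_subalgD(5)[OF K] by (metis subsetD)
qed

text \<open>Taylor expansion in \<open>t\<^sub>2\<close>, with coefficients that commute with \<open>P\<^sub>1\<close>.\<close>

lemma nilpotent_weight_vector_mem_aux:
  assumes x: "x \<in> carrier A" and P: "W1.ad P1 x = \<zero>" "(W1.ad P2 ^^ n) x = \<zero>"
    and w: "W1.ad d1 x = of_int m1 \<odot> x" "W1.ad d2 x = of_int m2 \<odot> x"
  shows "x \<in> K"
proof (rule W1.taylor[where x = P2 and t = s2 and m = m2 and n = n and
      V = "\<lambda>m. {y \<in> carrier A. W1.ad P1 y = \<zero> \<and> W1.ad d1 y = of_int m1 \<odot> y \<and> W1.ad d2 y = of_int m \<odot> y}"])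
  fix m y assume y: "y \<in> {y \<in> carrier A. W1.ad P1 y = \<zero> \<and> W1.ad d1 y = of_int m1 \<odot> y \<and> W1.ad d2 y = of_int m \<odot> y}"
  then show "W1.ad P2 y \<in> {y \<in> carrier A. W1.ad P1 y = \<zero> \<and> W1.ad d1 y = of_int m1 \<odot> y \<and> W1.ad d2 y = of_int (m - 1) \<odot> y}"
    using W1.ad_commute[of P1 P2 y] W1.ad_commute[of d1 P2 y] W2.ad_d_ad_P[of y "of_int m"] by simp
  show "s2 \<otimes> y \<in> {y \<in> carrier A. W1.ad P1 y = \<zero> \<and> W1.ad d1 y = of_int m1 \<odot> y \<and> W1.ad d2 y = of_int (m + 1) \<odot> y}"
    using y W2.ad_d_t_mult[of y "of_int m"] by (simp add: W1.ad_mult W1.smult_mult_right)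
  show "y \<in> K" if "W1.ad P2 y = \<zero>"
    using y that weight_vector_killed_by_P_mem by blast
next
  show "s2 \<in> K" using t_B BK by auto
qed (use assms K in \<open>auto simp: W1.scale_diff_right mult.commute W1.ad_diff\<close>)

text \<open>Taylor expansion in \<open>t\<^sub>1\<close>; its coefficients commute with \<open>P\<^sub>1\<close>, so the expansion in \<open>t\<^sub>2\<close> applies to
them.\<close>

lemma nilpotent_weight_vector_mem:
  assumes x: "x \<in> carrier A" and nil: "(W1.ad P1 ^^ n1) x = \<zero>" "(W1.ad P2 ^^ n2) x = \<zero>"
    and w: "W1.ad d1 x = of_int m1 \<odot> x" "W1.ad d2 x = of_int m2 \<odot> x"
  shows "x \<in> K"
proof (rule W1.taylor[where x = P1 and t = s1 and m = m1 and n = n1 and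
      V = "\<lambda>m. {y \<in> carrier A. (W1.ad P2 ^^ n2) y = \<zero> \<and> W1.ad d1 y = of_int m \<odot> y \<and> W1.ad d2 y = of_int m2 \<odot> y}"])
  fix m y assume y: "y \<in> {y \<in> carrier A. (W1.ad P2 ^^ n2) y = \<zero> \<and> W1.ad d1 y = of_int m \<odot> y \<and> W1.ad d2 y = of_int m2 \<odot> y}"
  then show "W1.ad P1 y \<in> {y \<in> carrier A. (W1.ad P2 ^^ n2) y = \<zero> \<and> W1.ad d1 y = of_int (m - 1) \<odot> y \<and> W1.ad d2 y = of_int m2 \<odot> y}"
    using W1.ad_commute[of d2 P1 y] W1.ad_d_ad_P[of y "of_int m"] by (simp add: W1.ad_funpow_commute)
  show "s1 \<otimes> y \<in> {y \<in> carrier A. (W1.ad P2 ^^ n2) y = \<zero> \<and> W1.ad d1 y = of_int (m + 1) \<odot> y \<and> W1.ad d2 y = of_int m2 \<odot> y}"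
    using y W1.ad_d_t_mult[of y "of_int m"] by (simp add: W1.ad_funpow_mult) (simp add: W1.ad_mult W1.smult_mult_right)
  show "y \<in> K" if "W1.ad P1 y = \<zero>"
    using y that nilpotent_weight_vector_mem_aux by blast
next
  show "s1 \<in> K" using t_B BK by auto
qed (use assms K in \<open>auto simp: W1.scale_diff_right mult.commute W1.ad_diff W1.ad_funpow_diff W1.ad_funpow_scale\<close>)

end

end

section \<open>Tensor products of commuting subalgebras\<close>

text \<open>The tensor product is the quotient of the monoid algebra \<open>T\<close> by the ideal \<open>J\<close>. Working with \<open>T\<close> modulo
\<open>J\<close> keeps the additive structure that of the type of finitely supported functions.\<close>

locale commuting_subalgebras = complex_alg Q for Q :: "(complex, 'q) module" (structure) +
  fixes B H
  assumes B: "is_subalg B Q" and H: "is_subalg H Q"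
    and comm: "\<And>b u. b \<in> B \<Longrightarrow> u \<in> H \<Longrightarrow> b \<otimes> u = u \<otimes> b"
begin

abbreviation "QB \<equiv> Q\<lparr>carrier := B\<rparr>"
abbreviation "QH \<equiv> Q\<lparr>carrier := H\<rparr>"
abbreviation "T \<equiv> monoid_alg (QB \<times>\<times> QH)"
abbreviation "J \<equiv> tensor_ideal QB QH"
abbreviation sing :: "'q \<Rightarrow> 'q \<Rightarrow> complex \<Rightarrow> 'q \<times> 'q \<Rightarrow>\<^sub>0 complex"
  where "sing b u c \<equiv> Poly_Mapping.single (b, u) c"

lemmas BD = is_subalgD[OF B]
lemmas HD = is_subalgD[OF H]

lemma B_carrier: "b \<in> B \<Longrightarrow> b \<in> carrier Q" using BD(1) by blast
lemma H_carrier: "u \<in> H \<Longrightarrow> u \<in> carrier Q" using HD(1) by blast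

lemma monoid_BH: "Group.monoid (QB \<times>\<times> QH)"
  by (rule DirProd_monoid[OF monoid_subalg[OF B] monoid_subalg[OF H]])

lemma complex_algebra_T: "complex_algebra T"
  by (rule complex_algebra_monoid_alg[OF monoid_BH])

sublocale T: complex_alg T
  using complex_algebra_T by (simp add: complex_alg_def)

lemma carrier_T: "carrier T = {f. Poly_Mapping.keys f \<subseteq> B \<times> H}"
  by (simp add: DirProd_def)

lemma sing_T: "b \<in> B \<Longrightarrow> u \<in> H \<Longrightarrow> sing b u c \<in> carrier T"
  by (simp add: DirProd_def)

lemma tensor_relations_T: "tensor_relations QB QH \<subseteq> carrier T"
  unfolding tensor_relations_def carrier_T
  by (auto simp: BD(4,6) HD(4,6) dest!: keys_diff[THEN subsetD] split: if_splits)

lemma ideal_J: "ideal J T"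
  unfolding tensor_ideal_def by (rule T.genideal_ideal[OF tensor_relations_T])

lemma J_relation: "r \<in> tensor_relations QB QH \<Longrightarrow> r \<in> J"
  unfolding tensor_ideal_def using T.genideal_self[OF tensor_relations_T] by blast

lemma QN_sel:
  "carrier (Q\<lparr>carrier := N\<rparr>) = N" "add (Q\<lparr>carrier := N\<rparr>) = add Q"
  "smult (Q\<lparr>carrier := N\<rparr>) = smult Q"
  by simp_all

lemma J_relations:
  "b \<in> B \<Longrightarrow> b' \<in> B \<Longrightarrow> u \<in> H \<Longrightarrow> sing (b \<oplus> b') u 1 - sing b u 1 - sing b' u 1 \<in> J"
  "b \<in> B \<Longrightarrow> u \<in> H \<Longrightarrow> u' \<in> H \<Longrightarrow> sing b (u \<oplus> u') 1 - sing b u 1 - sing b u' 1 \<in> J"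
  "b \<in> B \<Longrightarrow> u \<in> H \<Longrightarrow> sing (c \<odot> b) u 1 - sing b u c \<in> J"
  "b \<in> B \<Longrightarrow> u \<in> H \<Longrightarrow> sing b (c \<odot> u) 1 - sing b u c \<in> J"
  by (rule J_relation; simp only: tensor_relations_def QN_sel Un_iff mem_Collect_eq; blast)+

lemma J_zero: "b \<in> B \<Longrightarrow> sing b \<zero> 1 \<in> J" "u \<in> H \<Longrightarrow> sing \<zero> u 1 \<in> J"
  using J_relations(4)[of b \<zero> 0] J_relations(3)[of \<zero> u 0] BD(3) HD(3) by simp_all

lemmas J_closed = monoid_alg_ideal_closed[OF ideal_J]

definition \<mu> :: "('q \<times> 'q \<Rightarrow>\<^sub>0 complex) \<Rightarrow> 'q" where "\<mu> = lift_monoid (\<lambda>(b, u). b \<otimes> u)"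

lemma \<mu>_sing: "b \<in> B \<Longrightarrow> u \<in> H \<Longrightarrow> \<mu> (sing b u c) = c \<odot> (b \<otimes> u)"
  unfolding \<mu>_def by (subst lift_monoid_single) (auto simp: B_carrier H_carrier)

text \<open>Multiplicativity on basis vectors is where commutation enters: \<open>b b' u u' = (b u) (b' u')\<close>.\<close>

lemma \<mu>_hom: "\<mu> \<in> alg_hom T Q"
  unfolding \<mu>_def
proof (rule lift_monoid_hom[OF monoid_BH])
  fix x y assume xy: "x \<in> carrier (QB \<times>\<times> QH)" "y \<in> carrier (QB \<times>\<times> QH)"
  obtain b u b' u' where e: "x = (b, u)" "y = (b', u')" by (cases x; cases y)
  then have m: "b \<in> B" "u \<in> H" "b' \<in> B" "u' \<in> H" using xy by (auto simp: DirProd_def)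
  have c: "b \<in> carrier Q" "u \<in> carrier Q" "b' \<in> carrier Q" "u' \<in> carrier Q"
    using m B_carrier H_carrier by auto
  have "(b \<otimes> b') \<otimes> (u \<otimes> u') = b \<otimes> ((b' \<otimes> u) \<otimes> u')" using c by (simp add: m_assoc)
  also have "\<dots> = (b \<otimes> u) \<otimes> (b' \<otimes> u')" using c by (simp add: comm[OF m(3,2)] m_assoc)
  finally show "(\<lambda>(b, u). b \<otimes> u) (x \<otimes>\<^bsub>QB \<times>\<times> QH\<^esub> y) = (\<lambda>(b, u). b \<otimes> u) x \<otimes> (\<lambda>(b, u). b \<otimes> u) y"
    by (simp add: e DirProd_def)
qed (auto simp: DirProd_def B_carrier H_carrier)

lemma \<mu>_J:
  assumes "f \<in> J" shows "\<mu> f = \<zero>"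
proof -
  let ?K = "{f \<in> carrier T. \<mu> f = \<zero>}"
  have K: "ideal ?K T"
    by (rule ideal_kernel[OF complex_algebra_T _ \<mu>_hom]) (rule complex_algebra_axioms)
  have sub: "f - g \<in> ?K" if f: "f \<in> carrier T" and g: "g \<in> carrier T" and e: "\<mu> f = \<mu> g" for f g
  proof -
    have "f \<ominus>\<^bsub>T\<^esub> g \<in> carrier T" using f g by (rule T.minus_closed)
    moreover have "\<mu> (f \<ominus>\<^bsub>T\<^esub> g) = \<mu> f \<oplus> (-1) \<odot> \<mu> g"
      using f g alg_homD(3)[OF \<mu>_hom, of f "(-1) \<odot>\<^bsub>T\<^esub> g"] alg_homD(5)[OF \<mu>_hom, of g "-1"]
      by (simp only: T.minus_eq T.minus_eq_scale T.scale_closed)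
    ultimately show ?thesis
      using monoid_alg_minus[OF monoid_BH f g] e alg_homD(1)[OF \<mu>_hom g]
      by (simp add: minus_eq_scale[symmetric] r_neg)
  qed
  have add: "sing b u c + sing b' u' c' \<in> carrier T \<and>
      \<mu> (sing b u c + sing b' u' c') = c \<odot> (b \<otimes> u) \<oplus> c' \<odot> (b' \<otimes> u')"
    if "b \<in> B" "u \<in> H" "b' \<in> B" "u' \<in> H" for b u b' u' c c'
    using that alg_homD(3)[OF \<mu>_hom, of "sing b u c" "sing b' u' c'"] sing_T[of b u c] sing_T[of b' u' c']
      T.a_closed[of "sing b u c" "sing b' u' c'"] \<mu>_sing by simp
  have "tensor_relations QB QH \<subseteq> ?K"
  proof
    fix r assume "r \<in> tensor_relations QB QH"
    then consider
        b b' u where "b \<in> B" "b' \<in> B" "u \<in> H" "r = sing (b \<oplus> b') u 1 - (sing b u 1 + sing b' u 1)"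
      | b u u' where "b \<in> B" "u \<in> H" "u' \<in> H" "r = sing b (u \<oplus> u') 1 - (sing b u 1 + sing b u' 1)"
      | c b u where "b \<in> B" "u \<in> H" "r = sing (c \<odot> b) u 1 - sing b u c"
      | c b u where "b \<in> B" "u \<in> H" "r = sing b (c \<odot> u) 1 - sing b u c"
      unfolding tensor_relations_def by (auto simp: diff_diff_eq)
    then show "r \<in> ?K"
    proof cases
      case 1
      then show ?thesis
        using sub[of "sing (b \<oplus> b') u 1"] add[of b u b' u 1 1]
        by (simp add: sing_T \<mu>_sing BD HD B_carrier H_carrier l_distr del: monoid_alg_sel)
    next
      case 2
      then show ?thesis
        using sub[of "sing b (u \<oplus> u') 1"] add[of b u b u' 1 1]
        by (simp add: sing_T \<mu>_sing BD HD B_carrier H_carrier r_distr del: monoid_alg_sel)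
    next
      case 3
      then show ?thesis
        using sub[of "sing (c \<odot> b) u 1" "sing b u c"]
        by (simp add: sing_T \<mu>_sing BD HD B_carrier H_carrier smult_mult_left del: monoid_alg_sel)
    next
      case 4
      then show ?thesis
        using sub[of "sing b (c \<odot> u) 1" "sing b u c"]
        by (simp add: sing_T \<mu>_sing BD HD B_carrier H_carrier smult_mult_right del: monoid_alg_sel)
    qed
  qed
  then have "J \<subseteq> ?K" unfolding tensor_ideal_def using K by (intro T.genideal_minimal)
  then show ?thesis using assms by blast
qed

end

context weyl_pairs
begin

sublocale C: commuting_subalgebras A B H
  by (intro commuting_subalgebras.intro W1.complex_alg_axioms commuting_subalgebras_axioms.intro
      is_subalg_B is_subalg_H B_H_commute)

text \<open>\<open>f\<close> represents the tensor \<open>\<Sum> m\<^sub>i \<otimes> h i\<close> over the index set \<open>S\<close> and over every larger finite one. The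
freedom to enlarge \<open>S\<close> lets two expansions be added over the union of their index sets.\<close>

definition expansion :: "('a \<times> 'a \<Rightarrow>\<^sub>0 complex) \<Rightarrow> (int \<times> int \<times> nat \<times> nat \<Rightarrow> 'a) \<Rightarrow> (int \<times> int \<times> nat \<times> nat) set \<Rightarrow> bool"
  where "expansion f h S \<longleftrightarrow> finite S \<and> range h \<subseteq> H \<and>
    (\<forall>S'. finite S' \<longrightarrow> S \<subseteq> S' \<longrightarrow> f - (\<Sum>i\<in>S'. C.sing (monomial i) (h i) 1) \<in> C.J)"

lemma J_sum: "(\<And>i. i \<in> S \<Longrightarrow> f i \<in> C.J) \<Longrightarrow> (\<Sum>i\<in>S. f i) \<in> C.J"
  by (induction S rule: infinite_finite_induct) (auto intro: C.J_closed)

lemma expansion_cong: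
  assumes "expansion f h S" "g - f \<in> C.J"
  shows "expansion g h S"
  unfolding expansion_def
proof (intro conjI allI impI)
  fix S' assume "finite S'" "S \<subseteq> S'"
  then have "f - (\<Sum>i\<in>S'. C.sing (monomial i) (h i) 1) \<in> C.J"
    using assms(1) by (auto simp: expansion_def)
  from C.J_closed(2)[OF assms(2) this]
  show "g - (\<Sum>i\<in>S'. C.sing (monomial i) (h i) 1) \<in> C.J" by simp
qed (use assms(1) in \<open>auto simp: expansion_def\<close>)

lemma expansion_add:
  assumes "expansion f h S" "expansion g k T"
  shows "expansion (f + g) (\<lambda>i. h i \<oplus> k i) (S \<union> T)"
  unfolding expansion_def
proof (intro conjI allI impI)
  have hk: "h i \<in> H" "k i \<in> H" for i using assms by (auto simp: expansion_def)
  then show "range (\<lambda>i. h i \<oplus> k i) \<subseteq> H" using C.HD(4) by auto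
  fix S' assume S': "finite S'" "S \<union> T \<subseteq> S'"
  let ?s = "\<lambda>h. \<Sum>i\<in>S'. C.sing (monomial i) (h i) 1"
  have 1: "(f - ?s h) + (g - ?s k) \<in> C.J"
    using assms S' by (intro C.J_closed(2)) (auto simp: expansion_def)
  have 2: "(\<Sum>i\<in>S'. C.sing (monomial i) (h i \<oplus> k i) 1 - C.sing (monomial i) (h i) 1 - C.sing (monomial i) (k i) 1) \<in> C.J"
    by (intro J_sum C.J_relations monomial_B hk)
  have 3: "(f + g) - ?s (\<lambda>i. h i \<oplus> k i) = ((f - ?s h) + (g - ?s k))
      - (\<Sum>i\<in>S'. C.sing (monomial i) (h i \<oplus> k i) 1 - C.sing (monomial i) (h i) 1 - C.sing (monomial i) (k i) 1)"
    by (simp add: sum_subtractf)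
  show "(f + g) - ?s (\<lambda>i. h i \<oplus> k i) \<in> C.J"
    unfolding 3 by (rule C.J_closed(3)[OF 1 2])
qed (use assms in \<open>auto simp: expansion_def\<close>)

lemma expansion_zero: "expansion 0 (\<lambda>i. \<zero>) {}"
  unfolding expansion_def
proof (intro conjI allI impI)
  fix S' :: "(int \<times> int \<times> nat \<times> nat) set"
  have "(\<Sum>i\<in>S'. C.sing (monomial i) \<zero> 1) \<in> C.J" by (intro J_sum C.J_zero monomial_B)
  from C.J_closed(3)[OF C.J_closed(1) this]
  show "0 - (\<Sum>i\<in>S'. C.sing (monomial i) \<zero> 1) \<in> C.J" .
qed (use C.HD(3) in auto)

lemma expansion_monomial:
  assumes u: "u \<in> H"
  shows "expansion (C.sing (monomial i) u 1) (\<lambda>j. if j = i then u else \<zero>) {i}"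
  unfolding expansion_def
proof (intro conjI allI impI)
  fix S' assume S': "finite S'" "{i} \<subseteq> S'"
  have "(\<Sum>j\<in>S' - {i}. C.sing (monomial j) \<zero> 1) \<in> C.J"
    by (intro J_sum C.J_zero monomial_B)
  from C.J_closed(3)[OF C.J_closed(1) this]
  have *: "- (\<Sum>j\<in>S' - {i}. C.sing (monomial j) \<zero> 1) \<in> C.J" by simp
  have "(\<Sum>j\<in>S'. C.sing (monomial j) (if j = i then u else \<zero>) 1)
      = C.sing (monomial i) u 1 + (\<Sum>j\<in>S' - {i}. C.sing (monomial j) (if j = i then u else \<zero>) 1)"
    using S' sum.remove[of S' i "\<lambda>j. C.sing (monomial j) (if j = i then u else \<zero>) 1"] by simp
  also have "(\<Sum>j\<in>S' - {i}. C.sing (monomial j) (if j = i then u else \<zero>) 1)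
      = (\<Sum>j\<in>S' - {i}. C.sing (monomial j) \<zero> 1)"
    by (rule sum.cong) auto
  finally show "C.sing (monomial i) u 1 - (\<Sum>j\<in>S'. C.sing (monomial j) (if j = i then u else \<zero>) 1) \<in> C.J"
    using * by simp
qed (use u C.HD(3) in auto)

text \<open>The elements \<open>b\<close> for which all tensors \<open>b \<otimes> u\<close> have an expansion form a linear subspace that contains
the monomials, hence all of \<open>B\<close>.\<close>

lemma expansion_sing:
  assumes b: "b \<in> B" and u: "u \<in> H"
  shows "\<exists>h S. expansion (C.sing b u c) h S"
proof -
  let ?N = "{b \<in> B. \<forall>u\<in>H. \<exists>h S. expansion (C.sing b u 1) h S}"
  have "submodule ?N complex_ring A"
  proof (rule W1.is_submoduleI)
    have "\<exists>h S. expansion (C.sing \<zero> u 1) h S" if "u \<in> H" for u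
      using expansion_cong[OF expansion_zero, of "C.sing \<zero> u 1"] C.J_zero(2)[OF that] by auto
    then show "\<zero> \<in> ?N" using C.BD(3) by auto
  next
    fix x y assume xy: "x \<in> ?N" "y \<in> ?N"
    have "\<exists>h S. expansion (C.sing (x \<oplus> y) u 1) h S" if u: "u \<in> H" for u
    proof -
      obtain h S k T where "expansion (C.sing x u 1) h S" "expansion (C.sing y u 1) k T"
        using xy u by blast
      note expansion_add[OF this]
      moreover have "C.sing (x \<oplus> y) u 1 - (C.sing x u 1 + C.sing y u 1) \<in> C.J"
        using C.J_relations(1)[of x y u] xy u by (simp add: diff_diff_eq)
      ultimately show ?thesis using expansion_cong by blast
    qed
    then show "x \<oplus> y \<in> ?N" using xy C.BD(4) by auto
  next
    fix c x assume x: "x \<in> ?N"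
    have "\<exists>h S. expansion (C.sing (c \<odot> x) u 1) h S" if u: "u \<in> H" for u
    proof -
      obtain h S where "expansion (C.sing x (c \<odot> u) 1) h S"
        using x u C.HD(6) by blast
      moreover have "C.sing (c \<odot> x) u 1 - C.sing x (c \<odot> u) 1 \<in> C.J"
        using C.J_closed(3)[OF C.J_relations(3)[of x u c] C.J_relations(4)[of x u c]] x u by simp
      ultimately show ?thesis using expansion_cong by blast
    qed
    then show "c \<odot> x \<in> ?N" using x C.BD(6) by auto
  qed (use C.B_carrier in auto)
  moreover have "range monomial \<subseteq> ?N" using expansion_monomial monomial_B by blast
  ultimately have "linear_span A (range monomial) \<subseteq> ?N" by (rule W1.linear_span_least)
  then have "b \<in> ?N" using b B_subset_span_monomial by blast
  moreover have "c \<odot> u \<in> H" using u C.HD(6) by blast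
  ultimately obtain h S where hS: "expansion (C.sing b (c \<odot> u) 1) h S" by blast
  have "C.sing b u c - C.sing b (c \<odot> u) 1 \<in> C.J"
    using C.J_closed(3)[OF C.J_closed(1) C.J_relations(4)[OF b u, of c]] by simp
  with hS show ?thesis using expansion_cong by blast
qed

lemma expansion_exists:
  assumes "f \<in> carrier C.T"
  shows "\<exists>h S. expansion f h S"
proof -
  have "Poly_Mapping.keys f \<subseteq> B \<times> H" using assms by (simp only: C.carrier_T mem_Collect_eq)
  then show ?thesis
  proof (induction f rule: poly_mapping_induct_on)
    case (single x c)
    then show ?case using expansion_sing[of "fst x" "snd x" c] by auto
  qed (use expansion_zero expansion_add in blast)+
qed

lemma \<mu>_sum:
  assumes "finite S" "\<And>i. i \<in> S \<Longrightarrow> h i \<in> H"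
  shows "(\<Sum>i\<in>S. C.sing (monomial i) (h i) 1) \<in> carrier C.T \<and>
    C.\<mu> (\<Sum>i\<in>S. C.sing (monomial i) (h i) 1) = (\<Oplus>i\<in>S. monomial i \<otimes> h i)"
  using assms
proof (induction S)
  case empty
  have "0 \<in> carrier C.T" "C.\<mu> 0 = \<zero>"
    using C.\<mu>_J[OF C.J_closed(1)] by (auto simp: C.carrier_T)
  then show ?case by simp
next
  case (insert i S)
  let ?x = "C.sing (monomial i) (h i) 1" and ?y = "\<Sum>i\<in>S. C.sing (monomial i) (h i) 1"
  have hi: "h i \<in> H" and hc: "\<And>j. j \<in> insert i S \<Longrightarrow> h j \<in> carrier A"
    using insert.prems H_closed by blast+
  have IH: "?y \<in> carrier C.T" "C.\<mu> ?y = (\<Oplus>i\<in>S. monomial i \<otimes> h i)"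
    using insert.IH insert.prems by blast+
  have xy: "?x \<in> carrier C.T" "?y \<in> carrier C.T"
    using C.sing_T[OF monomial_B hi] IH by blast+
  have "?x + ?y \<in> carrier C.T" using C.T.a_closed[OF xy] by simp
  moreover have "C.\<mu> (?x + ?y) = C.\<mu> ?x \<oplus> C.\<mu> ?y"
    using alg_homD(3)[OF C.\<mu>_hom xy] by simp
  moreover have "C.\<mu> ?x = monomial i \<otimes> h i"
    using C.\<mu>_sing[OF monomial_B hi] hc by simp
  moreover have "(\<Oplus>i\<in>insert i S. monomial i \<otimes> h i) = monomial i \<otimes> h i \<oplus> (\<Oplus>i\<in>S. monomial i \<otimes> h i)"
    by (rule W1.finsum_insert) (use insert.hyps hc in \<open>simp_all add: Pi_iff\<close>)
  ultimately show ?case using insert.hyps IH by simp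
qed

text \<open>In an expansion of an element of the kernel all coefficients vanish by independence over \<open>H\<close>, and
\<open>m \<otimes> 0 = 0\<close>.\<close>

lemma \<mu>_kernel:
  assumes f: "f \<in> carrier C.T" and 0: "C.\<mu> f = \<zero>"
  shows "f \<in> C.J"
proof -
  obtain h S where e: "expansion f h S" using expansion_exists[OF f] by blast
  then have S: "finite S" and h: "h i \<in> H" for i by (auto simp: expansion_def)
  let ?s = "\<Sum>i\<in>S. C.sing (monomial i) (h i) 1"
  have d: "f - ?s \<in> C.J" using e S by (auto simp: expansion_def)
  have s: "?s \<in> carrier C.T" "C.\<mu> ?s = (\<Oplus>i\<in>S. monomial i \<otimes> h i)" using \<mu>_sum[of S h] S h by auto
  have dT: "f - ?s \<in> carrier C.T"
    using C.T.minus_closed[OF f s(1)] monoid_alg_minus[OF C.monoid_BH f s(1)] by simp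
  have "C.\<mu> ((f - ?s) + ?s) = C.\<mu> (f - ?s) \<oplus> C.\<mu> ?s"
    using alg_homD(3)[OF C.\<mu>_hom dT s(1)] by simp
  then have "(\<Oplus>i\<in>S. monomial i \<otimes> h i) = \<zero>"
    using 0 C.\<mu>_J[OF d] s(2) alg_homD(1)[OF C.\<mu>_hom s(1)] by simp
  moreover have "k + l \<le> Max ((\<lambda>(a, b, k, l). k + l) ` S)" if "(a, b, k, l) \<in> S" for a b k l
    using S that by (intro Max_ge) force+
  ultimately have h0: "h i = \<zero>" if "i \<in> S" for i
    using monomial_independent[where S = S and h = h and i = i and n = "Max ((\<lambda>(a, b, k, l). k + l) ` S)"]
      S h that by blast
  have "?s \<in> C.J"
    by (rule J_sum) (simp add: h0 C.J_zero monomial_B)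
  from C.J_closed(2)[OF d this] show ?thesis by simp
qed

text \<open>Passing from \<open>\<mu>\<close> on the monoid algebra to the induced map on its quotient, which is injective because
the kernel of \<open>\<mu>\<close> is exactly \<open>J\<close>.\<close>

lemma tensor_iso:
  assumes surj: "C.\<mu> ` carrier C.T = carrier A"
  shows "carrier A = linear_span A {b \<otimes> u | b u. b \<in> B \<and> u \<in> H} \<and>
    (\<exists>\<psi>\<in>alg_iso (tensor_alg C.QB C.QH) A. \<forall>b\<in>B. \<forall>u\<in>H. \<psi> (pure_tensor C.QB C.QH b u) = b \<otimes> u)"
proof
  let ?X = "{b \<otimes> u | b u. b \<in> B \<and> u \<in> H}"
  have X: "?X \<subseteq> carrier A" using B_closed H_closed by auto
  have sm: "submodule (linear_span A ?X) complex_ring A" by (rule W1.submodule_linear_span[OF X])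
  note D = W1.is_submoduleD[OF sm]
  have mem: "C.\<mu> f \<in> linear_span A ?X" if "Poly_Mapping.keys f \<subseteq> B \<times> H" for f
    using that
  proof (induction f rule: poly_mapping_induct_on)
    case zero
    then show ?case using D(2) C.\<mu>_J[OF C.J_closed(1)] by simp
  next
    case (single x c)
    then have "fst x \<in> B" "snd x \<in> H" by auto
    then have "fst x \<otimes> snd x \<in> ?X" by blast
    then have "fst x \<otimes> snd x \<in> linear_span A ?X" by (rule subsetD[OF W1.linear_span_superset])
    with single show ?case using D(4) C.\<mu>_sing[of "fst x" "snd x" c] by auto
  next
    case (add f g)
    then have "f \<in> carrier C.T" "g \<in> carrier C.T" by (simp_all only: C.carrier_T mem_Collect_eq)
    with add show ?case using alg_homD(3)[OF C.\<mu>_hom, of f g] D(3) by simp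
  qed
  then have "carrier A \<subseteq> linear_span A ?X"
    unfolding surj[symmetric] C.carrier_T by auto
  with D(1) show "carrier A = linear_span A ?X" by blast
next
  obtain \<psi> where \<psi>: "\<psi> \<in> alg_hom (quotient_alg C.T C.J) A"
    and \<psi>_\<mu>: "\<And>f. f \<in> carrier C.T \<Longrightarrow> \<psi> (C.J +>\<^bsub>C.T\<^esub> f) = C.\<mu> f"
    using induced_hom[OF C.complex_algebra_T W1.complex_algebra_axioms C.ideal_J C.\<mu>_hom C.\<mu>_J] by metis
  have "bij_betw \<psi> (carrier (quotient_alg C.T C.J)) (carrier A)"
    unfolding bij_betw_def
  proof
    show "inj_on \<psi> (carrier (quotient_alg C.T C.J))"
    proof (rule inj_onI)
      fix X Y assume X: "X \<in> carrier (quotient_alg C.T C.J)" and Y: "Y \<in> carrier (quotient_alg C.T C.J)"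
        and e: "\<psi> X = \<psi> Y"
      obtain f where f: "f \<in> carrier C.T" "X = C.J +>\<^bsub>C.T\<^esub> f" by (rule C.T.quotient_carrierE[OF X])
      obtain g where g: "g \<in> carrier C.T" "Y = C.J +>\<^bsub>C.T\<^esub> g" by (rule C.T.quotient_carrierE[OF Y])
      have d: "f - g \<in> carrier C.T"
        using C.T.minus_closed[OF f(1) g(1)] monoid_alg_minus[OF C.monoid_BH f(1) g(1)] by simp
      have "C.\<mu> ((f - g) + g) = C.\<mu> (f - g) \<oplus> C.\<mu> g"
        using alg_homD(3)[OF C.\<mu>_hom d g(1)] by simp
      moreover have "C.\<mu> f = C.\<mu> g"
        using e \<psi>_\<mu>[OF f(1)] \<psi>_\<mu>[OF g(1)] by (simp only: f(2) g(2))
      ultimately have "C.\<mu> (f - g) \<oplus> C.\<mu> g = C.\<mu> g" by (simp only: diff_add_cancel)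
      then have "C.\<mu> (f - g) = \<zero>"
        using alg_homD(1)[OF C.\<mu>_hom d] alg_homD(1)[OF C.\<mu>_hom g(1)] by simp
      then have "f - g \<in> C.J" using \<mu>_kernel[OF d] by simp
      then show "X = Y" using monoid_alg_coset_eqI[OF C.monoid_BH C.ideal_J f(1) g(1)] by (simp only: f(2) g(2))
    qed
    show "\<psi> ` carrier (quotient_alg C.T C.J) = carrier A"
    proof
      show "\<psi> ` carrier (quotient_alg C.T C.J) \<subseteq> carrier A" by (rule image_subsetI) (rule alg_homD(1)[OF \<psi>])
      show "carrier A \<subseteq> \<psi> ` carrier (quotient_alg C.T C.J)"
      proof
        fix x assume "x \<in> carrier A"
        then obtain f where f: "f \<in> carrier C.T" "x = C.\<mu> f" using surj by blast
        show "x \<in> \<psi> ` carrier (quotient_alg C.T C.J)"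
        proof (rule image_eqI)
          show "x = \<psi> (C.J +>\<^bsub>C.T\<^esub> f)" by (simp only: f(2) \<psi>_\<mu>[OF f(1)])
        qed (rule alg_homD(1)[OF C.T.coset_hom[OF C.ideal_J] f(1)])
      qed
    qed
  qed
  moreover have "\<psi> (pure_tensor C.QB C.QH b u) = b \<otimes> u" if "b \<in> B" "u \<in> H" for b u
    unfolding pure_tensor_def using \<psi>_\<mu>[OF C.sing_T[OF that]] C.\<mu>_sing[OF that] that B_closed H_closed
    by simp
  ultimately show "\<exists>\<psi>\<in>alg_iso (tensor_alg C.QB C.QH) A. \<forall>b\<in>B. \<forall>u\<in>H. \<psi> (pure_tensor C.QB C.QH b u) = b \<otimes> u"
    using \<psi> unfolding tensor_alg_def alg_iso_def by blast
qed

lemma B_subset_image: "B \<subseteq> C.\<mu> ` carrier C.T"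
proof
  fix b assume b: "b \<in> B"
  have "C.\<mu> (C.sing b \<one> 1) = b" using C.\<mu>_sing[OF b C.HD(2)] B_closed[OF b] by simp
  then show "b \<in> C.\<mu> ` carrier C.T" using C.sing_T[OF b C.HD(2)] by (metis imageI)
qed

lemma H_subset_image: "H \<subseteq> C.\<mu> ` carrier C.T"
proof
  fix u assume u: "u \<in> H"
  have "C.\<mu> (C.sing \<one> u 1) = u" using C.\<mu>_sing[OF C.BD(2) u] H_closed[OF u] by simp
  then show "u \<in> C.\<mu> ` carrier C.T" using C.sing_T[OF C.BD(2) u] by (metis imageI)
qed

lemma is_subalg_image_\<mu>: "is_subalg (C.\<mu> ` carrier C.T) A"
  by (rule is_subalg_image[OF C.complex_algebra_T W1.complex_algebra_axioms C.\<mu>_hom])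

end

section \<open>Homomorphisms from enveloping algebras\<close>

lemma monoid_word_monoid: "Group.monoid (word_monoid L)"
  by (rule monoidI) (auto simp: word_monoid_def)

lemma word_monoid_sel [simp]:
  "carrier (word_monoid L) = lists L" "mult (word_monoid L) = (@)" "one (word_monoid L) = []"
  by (simp_all add: word_monoid_def)

text \<open>A homomorphism \<open>\<phi>\<close> from the enveloping algebra into \<open>Q\<close>. It is studied through the free algebra \<open>F\<close> (as \<open>\<Psi>\<close>)
and through the Lie algebra (as \<open>\<iota>\<close>).\<close>

locale env_hom = complex_alg Q for Q :: "(complex, 'q) module" (structure) +
  fixes L :: "'l::ab_group_add set" and sc br and \<phi> :: "('l list \<Rightarrow>\<^sub>0 complex) set \<Rightarrow> 'q"
  assumes L_add: "\<And>x y. x \<in> L \<Longrightarrow> y \<in> L \<Longrightarrow> x + y \<in> L"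
    and L_sc: "\<And>c x. x \<in> L \<Longrightarrow> sc c x \<in> L"
    and L_br: "\<And>x y. x \<in> L \<Longrightarrow> y \<in> L \<Longrightarrow> br x y \<in> L"
    and \<phi>: "\<phi> \<in> alg_hom (env_alg L sc br) Q"
begin

abbreviation "F \<equiv> monoid_alg (word_monoid L)"
abbreviation "I \<equiv> env_ideal L sc br"

sublocale F: complex_alg F
  using complex_algebra_monoid_alg[OF monoid_word_monoid] by (simp add: complex_alg_def)

lemma relations_subset: "env_relations L sc br \<subseteq> carrier F"
  unfolding env_relations_def
  by (auto simp: L_add L_sc L_br dest!: keys_diff[THEN subsetD] split: if_splits)

lemma ideal_I: "ideal I F"
  unfolding env_ideal_def by (rule F.genideal_ideal[OF relations_subset])

lemma relation_mem: "r \<in> env_relations L sc br \<Longrightarrow> r \<in> I"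
  unfolding env_ideal_def using F.genideal_self[OF relations_subset] by blast

definition \<Psi> :: "('l list \<Rightarrow>\<^sub>0 complex) \<Rightarrow> 'q" where "\<Psi> f = \<phi> (I +>\<^bsub>F\<^esub> f)"

lemma \<Psi>_hom: "\<Psi> \<in> alg_hom F Q"
  using alg_hom_comp[OF F.coset_hom[OF ideal_I]] \<phi>
  unfolding env_alg_def \<Psi>_def by blast

lemma \<Psi>_eqI: "f \<in> carrier F \<Longrightarrow> g \<in> carrier F \<Longrightarrow> f - g \<in> I \<Longrightarrow> \<Psi> f = \<Psi> g"
  unfolding \<Psi>_def using monoid_alg_coset_eqI[OF monoid_word_monoid ideal_I] by metis

definition \<iota> :: "'l \<Rightarrow> 'q" where "\<iota> x = \<phi> (env_incl L sc br x)"

lemma \<iota>_eq: "\<iota> x = \<Psi> (Poly_Mapping.single [x] 1)"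
  by (simp add: \<iota>_def env_incl_def \<Psi>_def)

lemma \<iota>_closed: "x \<in> L \<Longrightarrow> \<iota> x \<in> carrier Q"
  unfolding \<iota>_eq by (rule alg_homD(1)[OF \<Psi>_hom]) simp

lemma \<iota>_add:
  assumes "x \<in> L" "y \<in> L" shows "\<iota> (x + y) = \<iota> x \<oplus> \<iota> y"
proof -
  have "\<Psi> (Poly_Mapping.single [x + y] 1) = \<Psi> (Poly_Mapping.single [x] 1 \<oplus>\<^bsub>F\<^esub> Poly_Mapping.single [y] 1)"
  proof (rule \<Psi>_eqI)
    have "Poly_Mapping.single [x + y] 1 - Poly_Mapping.single [x] 1 - Poly_Mapping.single [y] (1::complex) \<in> I"
      by (rule relation_mem) (use assms in \<open>unfold env_relations_def, blast\<close>)
    then show "Poly_Mapping.single [x + y] 1 - (Poly_Mapping.single [x] 1 \<oplus>\<^bsub>F\<^esub> Poly_Mapping.single [y] 1) \<in> I"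
      by (simp add: diff_diff_eq)
    show "Poly_Mapping.single [x] 1 \<oplus>\<^bsub>F\<^esub> Poly_Mapping.single [y] 1 \<in> carrier F"
      by (rule F.a_closed) (use assms in auto)
  qed (use assms L_add in auto)
  also have "\<dots> = \<iota> x \<oplus> \<iota> y"
    unfolding \<iota>_eq by (rule alg_homD(3)[OF \<Psi>_hom]) (use assms in auto)
  finally show ?thesis by (simp add: \<iota>_eq)
qed

lemma \<iota>_scale:
  assumes "x \<in> L" shows "\<iota> (sc c x) = c \<odot> \<iota> x"
proof -
  have "\<Psi> (Poly_Mapping.single [sc c x] 1) = \<Psi> (c \<odot>\<^bsub>F\<^esub> Poly_Mapping.single [x] 1)"
  proof (rule \<Psi>_eqI)
    have "Poly_Mapping.single [sc c x] 1 - Poly_Mapping.single [x] c \<in> I"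
      by (rule relation_mem) (use assms in \<open>unfold env_relations_def, blast\<close>)
    then show "Poly_Mapping.single [sc c x] 1 - (c \<odot>\<^bsub>F\<^esub> Poly_Mapping.single [x] 1) \<in> I" by simp
  qed (use assms L_sc in auto)
  also have "\<dots> = c \<odot> \<iota> x"
    unfolding \<iota>_eq by (rule alg_homD(5)[OF \<Psi>_hom]) (use assms in auto)
  finally show ?thesis by (simp add: \<iota>_eq)
qed

lemma \<iota>_bracket:
  assumes "x \<in> L" "y \<in> L" shows "ad (\<iota> x) (\<iota> y) = \<iota> (br x y)"
proof -
  let ?x = "Poly_Mapping.single [x] 1" and ?y = "Poly_Mapping.single [y] 1"
    and ?z = "Poly_Mapping.single [br x y] 1"
  have xyz: "?x \<in> carrier F" "?y \<in> carrier F" "?z \<in> carrier F"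
    using assms L_br by auto
  note closed = F.m_closed[OF xyz(1,2)] F.m_closed[OF xyz(2,1)]
  note \<Psi>D = alg_homD[OF \<Psi>_hom]
  have "\<Psi> (?x \<otimes>\<^bsub>F\<^esub> ?y) = \<Psi> (?y \<otimes>\<^bsub>F\<^esub> ?x \<oplus>\<^bsub>F\<^esub> ?z)"
  proof (rule \<Psi>_eqI)
    have "Poly_Mapping.single [x, y] 1 - Poly_Mapping.single [y, x] 1 - Poly_Mapping.single [br x y] (1::complex) \<in> I"
      by (rule relation_mem) (use assms in \<open>unfold env_relations_def, blast\<close>)
    then show "?x \<otimes>\<^bsub>F\<^esub> ?y - (?y \<otimes>\<^bsub>F\<^esub> ?x \<oplus>\<^bsub>F\<^esub> ?z) \<in> I"
      by (simp add: diff_diff_eq)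
  qed (rule closed F.a_closed xyz)+
  also have "\<dots> = \<iota> y \<otimes> \<iota> x \<oplus> \<iota> (br x y)"
    by (simp only: \<iota>_eq \<Psi>D(3)[OF closed(2) xyz(3)] \<Psi>D(2)[OF xyz(2,1)])
  also have "\<Psi> (?x \<otimes>\<^bsub>F\<^esub> ?y) = \<iota> x \<otimes> \<iota> y"
    by (simp only: \<iota>_eq \<Psi>D(2)[OF xyz(1,2)])
  finally have *: "\<iota> x \<otimes> \<iota> y = \<iota> y \<otimes> \<iota> x \<oplus> \<iota> (br x y)" .
  have c: "\<iota> x \<in> carrier Q" "\<iota> y \<in> carrier Q" "\<iota> (br x y) \<in> carrier Q"
    using assms L_br \<iota>_closed by auto
  have r: "(a \<oplus> b) \<ominus> a = b" if "a \<in> carrier Q" "b \<in> carrier Q" for a b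
    using that by algebra
  show ?thesis unfolding commutator_def * using c by (intro r) auto
qed

text \<open>The enveloping algebra is generated by the Lie algebra.\<close>

lemma image_subset:
  assumes K: "is_subalg K Q" and gen: "\<And>x. x \<in> L \<Longrightarrow> \<iota> x \<in> K"
    and u: "u \<in> carrier (env_alg L sc br)"
  shows "\<phi> u \<in> K"
proof -
  note KD = is_subalgD[OF K] and \<Psi>D = alg_homD[OF \<Psi>_hom]
  have word: "\<Psi> (Poly_Mapping.single w c) \<in> K" if "w \<in> lists L" for w c
    using that
  proof induction
    case Nil
    have "\<Psi> (c \<odot>\<^bsub>F\<^esub> \<one>\<^bsub>F\<^esub>) = c \<odot> \<Psi> \<one>\<^bsub>F\<^esub>" by (rule \<Psi>D(5)) simp
    then show ?case using KD(6)[OF KD(2), of c] \<Psi>D(4) by simp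
  next
    case (Cons x w)
    have "\<Psi> (Poly_Mapping.single [x] 1 \<otimes>\<^bsub>F\<^esub> Poly_Mapping.single w c) = \<iota> x \<otimes> \<Psi> (Poly_Mapping.single w c)"
      unfolding \<iota>_eq by (rule \<Psi>D(2)) (use Cons in auto)
    then show ?case using KD(5)[OF gen[OF Cons(1)] Cons(3)] by simp
  qed
  obtain f where f: "Poly_Mapping.keys f \<subseteq> lists L" "u = I +>\<^bsub>F\<^esub> f"
    using F.quotient_carrierE u unfolding env_alg_def by (metis mem_Collect_eq monoid_alg_sel(1) word_monoid_sel(1))
  have "\<Psi> f \<in> K" using f(1)
  proof (induction f rule: poly_mapping_induct_on)
    case (add f g)
    then show ?case using KD(4) \<Psi>D(3)[of f g] by simp
  next
    case zero
    then show ?case using word[of "[]" 0] by simp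
  qed (rule word)
  then show ?thesis by (simp add: f \<Psi>_def)
qed

lemma env_mult_closed:
  assumes "u \<in> carrier (env_alg L sc br)" "v \<in> carrier (env_alg L sc br)"
  shows "u \<otimes>\<^bsub>env_alg L sc br\<^esub> v \<in> carrier (env_alg L sc br)"
proof -
  note c = alg_homD[OF F.coset_hom[OF ideal_I]]
  obtain f g where "f \<in> carrier F" "u = I +>\<^bsub>F\<^esub> f" "g \<in> carrier F" "v = I +>\<^bsub>F\<^esub> g"
    using F.quotient_carrierE assms unfolding env_alg_def by metis
  then show ?thesis using c(1,2) F.m_closed unfolding env_alg_def by metis
qed

lemma env_incl_closed: "x \<in> L \<Longrightarrow> env_incl L sc br x \<in> carrier (env_alg L sc br)"
  unfolding env_incl_def env_alg_def by (rule alg_homD(1)[OF F.coset_hom[OF ideal_I]]) simp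

lemma hom_nat_pow:
  assumes "u \<in> carrier (env_alg L sc br)"
  shows "u [^]\<^bsub>env_alg L sc br\<^esub> (n::nat) \<in> carrier (env_alg L sc br)
    \<and> \<phi> (u [^]\<^bsub>env_alg L sc br\<^esub> n) = \<phi> u [^] n"
proof (induction n)
  case 0
  have "\<one>\<^bsub>env_alg L sc br\<^esub> \<in> carrier (env_alg L sc br)"
    using alg_homD(1)[OF F.coset_hom[OF ideal_I] F.one_closed]
      alg_homD(4)[OF F.coset_hom[OF ideal_I]] unfolding env_alg_def by metis
  then show ?case using alg_homD(4)[OF \<phi>] by (simp add: nat_pow_def)
next
  case (Suc n)
  have "u [^]\<^bsub>env_alg L sc br\<^esub> Suc n = u [^]\<^bsub>env_alg L sc br\<^esub> n \<otimes>\<^bsub>env_alg L sc br\<^esub> u"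
    by (simp add: nat_pow_def)
  then show ?case using Suc assms env_mult_closed alg_homD(2)[OF \<phi>] by simp
qed

end

section \<open>Plane vector fields of constant divergence\<close>

abbreviation mon :: "complex \<Rightarrow> nat \<Rightarrow> nat \<Rightarrow> poly2" where "mon c i j \<equiv> Polynomial.monom (Polynomial.monom c i) j"

text \<open>The Hamiltonian vector field of \<open>q\<close>; it has divergence zero.\<close>

definition ham :: "poly2 \<Rightarrow> vfield" where "ham q = (pd2 q, - pd1 q)"

lemma coeff_pd1: "Polynomial.coeff (pd1 p) n = pderiv (Polynomial.coeff p n)"
  by (simp add: pd1_def coeff_map_poly)

lemma pd1_simps [simp]:
  "pd1 0 = 0" "pd1 1 = 0" "pd1 (p + q) = pd1 p + pd1 q" "pd1 (- p) = - pd1 p" "pd1 (p - q) = pd1 p - pd1 q"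
  "pd1 [:g:] = [:pderiv g:]"
  by (rule poly_eqI; simp add: coeff_pd1 pderiv_add pderiv_minus pderiv_diff coeff_pCons split: nat.splits)+

lemma pd2_simps [simp]:
  "pd2 0 = 0" "pd2 1 = 0" "pd2 (p + q) = pd2 p + pd2 q" "pd2 (- p) = - pd2 p" "pd2 (p - q) = pd2 p - pd2 q"
  "pd2 [:g:] = 0"
  by (simp_all add: pd2_def pderiv_add pderiv_minus pderiv_diff pderiv_pCons)

lemma pderiv_of_nat_mult: "pderiv (of_nat n * p) = of_nat n * pderiv p"
  by (simp add: of_nat_poly pderiv_smult)

lemma pd1_pd2: "pd1 (pd2 p) = pd2 (pd1 p)"
  by (rule poly_eqI) (simp add: coeff_pd1 pd2_def coeff_pderiv pderiv_of_nat_mult del: of_nat_Suc)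

lemma of_nat_mult_monom: "of_nat n * Polynomial.monom c i = Polynomial.monom (of_nat n * c) i" for c :: "'a::comm_semiring_1"
  by (metis mult_monom add_0 of_nat_monom)

lemma pd1_mon: "pd1 (mon c i j) = mon (of_nat i * c) (i - 1) j"
  by (rule poly_eqI) (simp add: coeff_pd1 pderiv_monom)

lemma pd2_mon: "pd2 (mon c i j) = mon (of_nat j * c) i (j - 1)"
  by (simp add: pd2_def pderiv_monom of_nat_mult_monom)

lemma const_eq_mon: "[:[:c:]:] = mon c 0 0"
  by (simp add: monom_0)

lemma t_eq_mon: "t1 = mon 1 1 0" "t2 = mon 1 0 1"
  by (simp_all add: t1_def t2_def monom_0 monom_Suc)

lemma pd_t [simp]: "pd1 t1 = 1" "pd2 t1 = 0" "pd1 t2 = 0" "pd2 t2 = 1"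
  by (simp_all add: t1_def t2_def pd1_def pd2_def map_poly_pCons pderiv_pCons one_pCons)

lemma ham_add:
  "ham (p + q) = ham p + ham q"
  by (simp add: ham_def)

lemma Sbar2_mem [simp]:
  "(1, 0) \<in> Sbar2" "(0, 1) \<in> Sbar2" "(t1, 0) \<in> Sbar2" "(0, t2) \<in> Sbar2" "ham q \<in> Sbar2"
proof -
  have "(1 :: poly2) = [:[:1:]:]" by (simp add: one_pCons)
  then show "(t1, 0) \<in> Sbar2" "(0, t2) \<in> Sbar2" by (auto simp: Sbar2_def)
  show "(1, 0) \<in> Sbar2" "(0, 1) \<in> Sbar2" "ham q \<in> Sbar2"
    by (auto simp: Sbar2_def ham_def pd1_pd2 intro: exI[of _ 0])
qed

lemma pd_scale [simp]:
  "pd1 (Polynomial.smult [:c:] p) = Polynomial.smult [:c:] (pd1 p)" "pd2 (Polynomial.smult [:c:] p) = Polynomial.smult [:c:] (pd2 p)"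
  by (rule poly_eqI; simp add: coeff_pd1 pd2_def pderiv_smult)+

lemma Sbar2_add [simp]: "p \<in> Sbar2 \<Longrightarrow> q \<in> Sbar2 \<Longrightarrow> p + q \<in> Sbar2"
proof -
  assume "p \<in> Sbar2" "q \<in> Sbar2"
  then obtain c d where "pd1 (fst p) + pd2 (snd p) = [:[:c:]:]" "pd1 (fst q) + pd2 (snd q) = [:[:d:]:]"
    by (auto simp: Sbar2_def)
  moreover have "pd1 (fst (p + q)) + pd2 (snd (p + q))
      = (pd1 (fst p) + pd2 (snd p)) + (pd1 (fst q) + pd2 (snd q))"
    by simp
  ultimately have "pd1 (fst (p + q)) + pd2 (snd (p + q)) = [:[:c + d:]:]" by simp
  then show ?thesis by (auto simp: Sbar2_def)
qed

lemma Sbar2_scale [simp]: "p \<in> Sbar2 \<Longrightarrow> vf_scale c p \<in> Sbar2"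
proof -
  assume "p \<in> Sbar2"
  then obtain d where "pd1 (fst p) + pd2 (snd p) = [:[:d:]:]" by (auto simp: Sbar2_def)
  then have "pd1 (fst (vf_scale c p)) + pd2 (snd (vf_scale c p)) = [:[:c * d:]:]"
    by (simp add: vf_scale_def flip: smult_add_right)
  then show ?thesis by (auto simp: Sbar2_def)
qed

lemma pd1_mult: "pd1 (p * q) = pd1 p * q + p * pd1 q"
proof (rule poly_eqI)
  fix n
  have "pderiv (\<Sum>i\<le>n. poly.coeff p i * poly.coeff q (n - i)) = (\<Sum>i\<le>n. pderiv (poly.coeff p i * poly.coeff q (n - i)))"
    using higher_pderiv_sum[of 1 "\<lambda>i. poly.coeff p i * poly.coeff q (n - i)" "{..n}"] by simp
  then show "poly.coeff (pd1 (p * q)) n = poly.coeff (pd1 p * q + p * pd1 q) n"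
    by (simp add: coeff_pd1 coeff_mult pderiv_mult sum.distrib) (simp add: algebra_simps)
qed

lemma pd2_mult: "pd2 (p * q) = pd2 p * q + p * pd2 q"
  by (simp add: pd2_def pderiv_mult algebra_simps)

text \<open>The divergence of \<open>[p, q]\<close> is \<open>p (div q) - q (div p)\<close>, which vanishes if both divergences are constant.\<close>

lemma Sbar2_bracket:
  assumes "p \<in> Sbar2" "q \<in> Sbar2"
  shows "vf_bracket p q \<in> Sbar2"
proof -
  have const: "pd1 (pd1 (fst p)) = - pd2 (pd1 (snd p))" "pd2 (pd1 (fst p)) = - pd2 (pd2 (snd p))"
    if p: "p \<in> Sbar2" for p
  proof -
    obtain c where "pd1 (fst p) + pd2 (snd p) = [:[:c:]:]" using p by (auto simp: Sbar2_def)
    then have "pd1 (pd1 (fst p) + pd2 (snd p)) = 0" "pd2 (pd1 (fst p) + pd2 (snd p)) = 0" by auto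
    then show "pd1 (pd1 (fst p)) = - pd2 (pd1 (snd p))" "pd2 (pd1 (fst p)) = - pd2 (pd2 (snd p))"
      by (simp_all add: pd1_pd2 eq_neg_iff_add_eq_0)
  qed
  have "pd1 (fst (vf_bracket p q)) + pd2 (snd (vf_bracket p q)) = 0"
    by (simp add: vf_bracket_def vf_apply_def pd1_mult pd2_mult pd1_pd2 const[OF assms(1)] const[OF assms(2)]
        algebra_simps)
  then show ?thesis by (auto simp: Sbar2_def intro: exI[of _ 0])
qed

lemma bracket_del_ham:
  "vf_bracket (1, 0) (ham q) = ham (pd1 q)" "vf_bracket (0, 1) (ham q) = ham (pd2 q)"
  by (simp_all add: vf_bracket_def vf_apply_def ham_def pd1_pd2)

lemma bracket_gens:
  "vf_bracket (1, 0) (t1, 0) = (1, 0)" "vf_bracket (0, 1) (0, t2) = (0, 1)"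
  "vf_bracket (1, 0) (0, 1) = 0" "vf_bracket (1, 0) (0, t2) = 0"
  "vf_bracket (0, 1) (t1, 0) = 0" "vf_bracket (t1, 0) (0, t2) = 0"
  by (simp_all add: vf_bracket_def vf_apply_def zero_prod_def)

text \<open>\<open>t\<^sub>1 \<partial>\<^sub>1\<close> has eigenvalue \<open>i\<close> on the function \<open>t\<^sub>1\<^sup>i t\<^sub>2\<^sup>j\<close>; the Hamiltonian field carries one more
\<open>\<partial>\<^sub>1\<close> or one less \<open>t\<^sub>1\<close>, which lowers the eigenvalue by one.\<close>

lemma bracket_euler_ham:
  "vf_bracket (t1, 0) (ham (mon c i j)) = vf_scale (of_int (int i - 1)) (ham (mon c i j))"
  "vf_bracket (0, t2) (ham (mon c i j)) = vf_scale (of_int (int j - 1)) (ham (mon c i j))"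
proof -
  have *: "mon a i j - mon b i j = mon (a - b) i j" "- mon a i j = mon (- a) i j" for a b i j
    by (simp_all add: diff_monom minus_monom)
  show "vf_bracket (t1, 0) (ham (mon c i j)) = vf_scale (of_int (int i - 1)) (ham (mon c i j))"
    unfolding vf_bracket_def vf_apply_def ham_def vf_scale_def const_eq_mon fst_conv snd_conv pd_t
    by (cases i; cases "i - 1")
      (simp_all add: pd1_mon pd2_mon * t_eq_mon mult_monom algebra_simps)
  show "vf_bracket (0, t2) (ham (mon c i j)) = vf_scale (of_int (int j - 1)) (ham (mon c i j))"
    unfolding vf_bracket_def vf_apply_def ham_def vf_scale_def const_eq_mon fst_conv snd_conv pd_t
    by (cases j; cases "j - 1")
      (simp_all add: pd1_mon pd2_mon * t_eq_mon mult_monom algebra_simps)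
qed

lemma pd_funpow_mon: "(pd1 ^^ Suc i) (mon c i j) = 0" "(pd2 ^^ Suc j) (mon c i j) = 0"
proof -
  show "(pd1 ^^ Suc i) (mon c i j) = 0"
  proof (induction i arbitrary: c)
    case (Suc i)
    show ?case by (subst funpow_Suc_right) (simp only: o_apply pd1_mon diff_Suc_1 Suc.IH)
  qed (simp add: pd1_mon)
  show "(pd2 ^^ Suc j) (mon c i j) = 0"
  proof (induction j arbitrary: c)
    case (Suc j)
    show ?case by (subst funpow_Suc_right) (simp only: o_apply pd2_mon diff_Suc_1 Suc.IH)
  qed (simp add: pd2_mon)
qed

lemma sum_induct_closed:
  assumes "P 0" "\<And>x y. P x \<Longrightarrow> P y \<Longrightarrow> P (x + y)" "\<And>i. i \<in> S \<Longrightarrow> P (f i)"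
  shows "P (\<Sum>i\<in>S. f i)"
  using assms by (induction S rule: infinite_finite_induct) auto

lemma poly2_induct [case_names mon add]:
  assumes mon: "\<And>c i j. P (mon c i j)" and add: "\<And>p q. P p \<Longrightarrow> P q \<Longrightarrow> P (p + q)"
  shows "P q"
proof -
  have P0: "P 0" using mon[of 0 0 0] by simp
  have 1: "P (Polynomial.monom r j)" for r j
  proof -
    have "P (\<Sum>i\<le>degree r. mon (Polynomial.coeff r i) i j)"
      by (rule sum_induct_closed) (use P0 add mon in auto)
    moreover have "(\<Sum>i\<le>degree r. mon (Polynomial.coeff r i) i j) = Polynomial.monom (\<Sum>i\<le>degree r. Polynomial.monom (Polynomial.coeff r i) i) j"
      by (rule poly_eqI) (simp add: coeff_sum)
    ultimately show ?thesis by (simp add: poly_as_sum_of_monoms)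
  qed
  have "P (\<Sum>j\<le>degree q. Polynomial.monom (Polynomial.coeff q j) j)"
    by (rule sum_induct_closed) (use P0 add 1 in auto)
  then show ?thesis by (simp add: poly_as_sum_of_monoms)
qed

text \<open>\<open>f n\<close> stands for division by \<open>n + 1\<close>, so that the coefficient ring may itself be a polynomial ring.\<close>

lemma antiderivative:
  fixes p :: "'a::idom poly" and f :: "nat \<Rightarrow> 'a \<Rightarrow> 'a"
  assumes "\<And>n a. of_nat (Suc n) * f n a = a"
  shows "\<exists>q. pderiv q = p"
proof -
  have "pderiv (\<Sum>i\<le>degree p. Polynomial.monom (f i (Polynomial.coeff p i)) (Suc i)) = (\<Sum>i\<le>degree p. Polynomial.monom (Polynomial.coeff p i) i)"
    using assms higher_pderiv_sum[of 1 "\<lambda>i. Polynomial.monom (f i (Polynomial.coeff p i)) (Suc i)" "{..degree p}"]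
    by (simp add: pderiv_monom del: of_nat_Suc)
  then show ?thesis by (metis poly_as_sum_of_monoms)
qed

text \<open>Removing a multiple of \<open>t\<^sub>1 \<partial>\<^sub>1\<close> makes the divergence zero, and a polynomial field without divergence is
Hamiltonian: integrate the first component in \<open>t\<^sub>2\<close>, then correct by a polynomial in \<open>t\<^sub>1\<close> alone.\<close>

lemma Sbar2_decompose:
  assumes "p \<in> Sbar2"
  obtains c q where "p = vf_scale c (t1, 0) + ham q"
proof -
  obtain c where c: "pd1 (fst p) + pd2 (snd p) = [:[:c:]:]" using assms by (auto simp: Sbar2_def)
  let ?s = "[:[:c:]:] * t1"
  obtain q1 where q1: "pd2 q1 = fst p - ?s"
    using antiderivative[of "\<lambda>n. Polynomial.smult (inverse (of_nat (Suc n)))" "fst p - ?s"]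
    by (auto simp: pd2_def of_nat_poly simp del: of_nat_Suc)
  define r where "r = snd p + pd1 q1"
  have "pd2 r = pd2 (snd p) + pd1 (fst p - ?s)"
    using q1 by (simp add: r_def pd1_pd2[symmetric])
  also have "\<dots> = (pd1 (fst p) + pd2 (snd p)) - [:[:c:]:]"
    by simp
  finally have "pderiv r = 0" using c by (simp add: pd2_def)
  then have "degree r = 0" by (simp add: pderiv_eq_0_iff)
  then obtain r0 where r0: "r = [:r0:]" by (rule degree_eq_zeroE)
  obtain g where g: "pderiv g = r0"
    using antiderivative[of "\<lambda>n a. a / of_nat (Suc n)" r0] by (auto simp del: of_nat_Suc)
  have "p = vf_scale c (t1, 0) + ham (q1 - [:g:])"
    using q1 r0 g by (simp add: prod_eq_iff vf_scale_def ham_def r_def algebra_simps)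
  then show ?thesis by (rule that)
qed

section \<open>The localization as a tensor product\<close>

theorem theorem5p4:
  fixes Q :: "(complex, 'q) module"
    and \<phi> :: "(vfield list \<Rightarrow>\<^sub>0 complex) set \<Rightarrow> 'q"
  assumes "is_ore_localization U_Sbar2 del_powers Q \<phi>"
  shows "carrier Q = BH Q \<phi> \<and>
    (\<exists>\<psi> \<in> alg_iso (tensor_alg (Q\<lparr>carrier := B_alg Q \<phi>\<rparr>) (Q\<lparr>carrier := H_alg Q \<phi>\<rparr>)) Q.
       \<forall>b\<in>B_alg Q \<phi>. \<forall>u\<in>H_alg Q \<phi>.
         \<psi> (pure_tensor (Q\<lparr>carrier := B_alg Q \<phi>\<rparr>) (Q\<lparr>carrier := H_alg Q \<phi>\<rparr>) b u) = b \<otimes>\<^bsub>Q\<^esub> u)"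
proof -
  have Q: "complex_algebra Q" and \<phi>: "\<phi> \<in> alg_hom (env_alg Sbar2 vf_scale vf_bracket) Q"
    and units: "\<And>s. s \<in> del_powers \<Longrightarrow> \<phi> s \<in> Units Q"
    and frac: "\<And>q. q \<in> carrier Q \<Longrightarrow> \<exists>s\<in>del_powers. \<exists>u\<in>carrier U_Sbar2. q = inv\<^bsub>Q\<^esub> (\<phi> s) \<otimes>\<^bsub>Q\<^esub> \<phi> u"
    using assms unfolding is_ore_localization_def U_Sbar2_def by blast+
  have Sbar2_bracket: "vf_bracket x y \<in> Sbar2" if "x \<in> Sbar2" "y \<in> Sbar2" for x y
    using that by (rule Sbar2_bracket)
  interpret E: env_hom Q Sbar2 vf_scale vf_bracket \<phi>
    using Q \<phi> Sbar2_bracket by (intro env_hom.intro env_hom_axioms.intro) (auto simp: complex_alg_def)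
  let ?P1 = "\<phi> del1" and ?P2 = "\<phi> del2" and ?d1 = "\<phi> d1" and ?d2 = "\<phi> d2"
  have \<iota>: "?P1 = E.\<iota> (1, 0)" "?P2 = E.\<iota> (0, 1)" "?d1 = E.\<iota> (t1, 0)" "?d2 = E.\<iota> (0, t2)"
    by (simp_all add: E.\<iota>_def del1_def del2_def d1_def d2_def vf_incl_def)
  have del_U: "del1 \<in> carrier U_Sbar2" "del2 \<in> carrier U_Sbar2"
    unfolding del1_def del2_def vf_incl_def U_Sbar2_def by (simp_all add: E.env_incl_closed del: quotient_alg_sel)
  have P: "?P1 \<in> carrier Q" "?P2 \<in> carrier Q" by (simp_all add: \<iota> E.\<iota>_closed)
  have \<phi>_pow: "\<phi> (del1 [^]\<^bsub>U_Sbar2\<^esub> i \<otimes>\<^bsub>U_Sbar2\<^esub> del2 [^]\<^bsub>U_Sbar2\<^esub> j) = ?P1 [^]\<^bsub>Q\<^esub> i \<otimes>\<^bsub>Q\<^esub> ?P2 [^]\<^bsub>Q\<^esub> j"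
    for i j :: nat
    using E.hom_nat_pow[of del1 i] E.hom_nat_pow[of del2 j] del_U alg_homD(2)[OF \<phi>]
    unfolding U_Sbar2_def by simp
  have "?P1 [^]\<^bsub>Q\<^esub> i \<otimes>\<^bsub>Q\<^esub> ?P2 [^]\<^bsub>Q\<^esub> j \<in> Units Q" for i j :: nat
    unfolding \<phi>_pow[symmetric] by (rule units) (auto simp: del_powers_def)
  \<comment> \<open>\<open>del_powers\<close> contains \<open>\<partial>\<^sub>1\<close> and \<open>\<partial>\<^sub>2\<close> themselves as \<open>\<partial>\<^sub>1\<^sup>1 \<partial>\<^sub>2\<^sup>0\<close> and \<open>\<partial>\<^sub>1\<^sup>0 \<partial>\<^sub>2\<^sup>1\<close>\<close>
  from this[of 1 0] this[of 0 1] have PU: "?P1 \<in> Units Q" "?P2 \<in> Units Q"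
    using P by simp_all
  have zero: "E.\<iota> 0 = \<zero>\<^bsub>Q\<^esub>"
    using E.\<iota>_scale[of "(1, 0)" 0] E.\<iota>_closed[of "(1, 0)"] by (simp add: vf_scale_def zero_prod_def)
  interpret weyl_pairs Q ?P1 ?d1 ?P2 ?d2
    by unfold_locales
      (simp_all add: PU, simp_all add: \<iota> E.\<iota>_closed E.\<iota>_bracket bracket_gens zero)
  have BH_eq: "B = B_alg Q \<phi>" "H = H_alg Q \<phi>"
    unfolding B_def B_alg_def H_def H_alg_def by auto
  define K where "K = C.\<mu> ` carrier C.T"
  have K: "is_subalg K Q" unfolding K_def by (rule is_subalg_image_\<mu>)
  have BK: "B \<subseteq> K" and HK: "H \<subseteq> K" unfolding K_def by (rule B_subset_image H_subset_image)+
  note KD = E.is_subalgD[OF K]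
  have ham_pow: "(E.ad ?P1 ^^ n) (E.\<iota> (ham q)) = E.\<iota> (ham ((pd1 ^^ n) q))"
    "(E.ad ?P2 ^^ n) (E.\<iota> (ham q)) = E.\<iota> (ham ((pd2 ^^ n) q))" for n q
    by (induction n) (simp_all add: \<iota> E.\<iota>_bracket bracket_del_ham)
  have ham0: "E.\<iota> (ham 0) = \<zero>\<^bsub>Q\<^esub>" using zero by (simp add: ham_def zero_prod_def)
  have ham: "E.\<iota> (ham q) \<in> K" for q
  proof (induction q rule: poly2_induct)
    case (mon c i j)
    show ?case
    proof (rule nilpotent_weight_vector_mem[OF K BK HK])
      \<comment> \<open>differentiating \<open>t\<^sub>1\<^sup>i t\<^sub>2\<^sup>j\<close> more than \<open>i\<close> times in \<open>t\<^sub>1\<close> gives zero, likewise for \<open>j\<close> and \<open>t\<^sub>2\<close>\<close>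
      show "(E.ad ?P1 ^^ Suc i) (E.\<iota> (ham (mon c i j))) = \<zero>\<^bsub>Q\<^esub>"
        "(E.ad ?P2 ^^ Suc j) (E.\<iota> (ham (mon c i j))) = \<zero>\<^bsub>Q\<^esub>"
        by (simp_all only: ham_pow pd_funpow_mon ham0)
      show "E.ad ?d1 (E.\<iota> (ham (mon c i j))) = complex_of_int (int i - 1) \<odot>\<^bsub>Q\<^esub> E.\<iota> (ham (mon c i j))"
        "E.ad ?d2 (E.\<iota> (ham (mon c i j))) = complex_of_int (int j - 1) \<odot>\<^bsub>Q\<^esub> E.\<iota> (ham (mon c i j))"
        by (simp_all only: \<iota> E.\<iota>_bracket Sbar2_mem bracket_euler_ham E.\<iota>_scale)
    qed (simp add: E.\<iota>_closed)
  next
    case (add p q)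
    then show ?case using KD(4) E.\<iota>_add[of "ham p" "ham q"] by (simp add: ham_add)
  qed
  have gens: "E.\<iota> x \<in> K" if x: "x \<in> Sbar2" for x
  proof -
    obtain c q where x: "x = vf_scale c (t1, 0) + ham q" using Sbar2_decompose[OF x] .
    have "?d1 \<in> K" using B_gens BK by blast
    then have "c \<odot>\<^bsub>Q\<^esub> E.\<iota> (t1, 0) \<in> K" using KD(6) \<iota> by simp
    then show ?thesis using ham[of q] KD(4) by (simp add: x E.\<iota>_add E.\<iota>_scale)
  qed
  have "carrier Q \<subseteq> K"
  proof
    fix q assume "q \<in> carrier Q"
    then obtain s u where su: "s \<in> del_powers" "u \<in> carrier U_Sbar2" "q = inv\<^bsub>Q\<^esub> (\<phi> s) \<otimes>\<^bsub>Q\<^esub> \<phi> u"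
      using frac by blast
    obtain i j :: nat where ij: "\<phi> s = ?P1 [^]\<^bsub>Q\<^esub> i \<otimes>\<^bsub>Q\<^esub> ?P2 [^]\<^bsub>Q\<^esub> j"
      using su(1) \<phi>_pow unfolding del_powers_def by blast
    have pow: "p [^]\<^bsub>Q\<^esub> n \<in> Units Q \<and> inv\<^bsub>Q\<^esub> (p [^]\<^bsub>Q\<^esub> n) \<in> K"
      if "p \<in> Units Q" "inv\<^bsub>Q\<^esub> p \<in> K" for p and n :: nat
      using that by (induction n) (auto simp: E.inv_mult_units KD(2,5))
    have "inv\<^bsub>Q\<^esub> ?P1 \<in> K" "inv\<^bsub>Q\<^esub> ?P2 \<in> K" using B_gens BK by auto
    with PU have "inv\<^bsub>Q\<^esub> (\<phi> s) \<in> K"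
      using pow[of ?P1 i] pow[of ?P2 j] by (simp add: ij E.inv_mult_units KD(5))
    moreover have "\<phi> u \<in> K"
      using su(2) unfolding U_Sbar2_def by (intro E.image_subset[OF K gens])
    ultimately show "q \<in> K" using su(3) KD(5) by simp
  qed
  then have "C.\<mu> ` carrier C.T = carrier Q" using KD(1) unfolding K_def by blast
  from tensor_iso[OF this] show ?thesis unfolding BH_def BH_eq .
qed

end
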